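(* The set of parameters $(\alpha,\beta)\in\Omega_\infty$ such that $T_{\alpha,\beta}$ does not have an eigenvalue $e^{2\pi i\xi}$ with $\xi\in(0,1)$ contains a dense $G_\delta$-subset of $\Omega_\infty$.
   Context: For $0<\beta\le\alpha\le 1$ let $T_{\alpha,\beta}:[0,1]\to[0,1]$ be $T_{\alpha,\beta}(x)=x+\alpha$ on $[0,1-\alpha)$, $x+\beta$ on $[1-\alpha,1-\beta)$, $x-1+\beta$ on $[1-\beta,1]$. Let $U=\{(\alpha,\beta):0<\beta\le\alpha\le1\}$, $U^\circ$ its interior, and $G(\alpha,\beta)=(\beta/\alpha,(\beta-1)/\alpha+\lfloor1/\alpha\rfloor)$. Then $\Omega_\infty=\{(\alpha,\beta): G^n(\alpha,\beta)\in U^\circ \text{ for all } n\ge0\}$ is the set of infinite type parameters, for which $T_{\alpha,\beta}$ acts on the Cantor set $\Omega=\bigcap_n\overline{T^n_{\alpha,\beta}([0,1])}$; $\Omega_\infty$ carries the subspace topology of $\mathbb R^2$. Eigenvalues refer to the Koopman operator $f\mapsto f\circ T_{\alpha,\beta}$ on $\Omega$. *)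

theory Defs
  imports "HOL-Analysis.Analysis" "HOL-Probability.Probability"
begin

definition T :: "real \<Rightarrow> real \<Rightarrow> real \<Rightarrow> real" where
  "T \<alpha> \<beta> x = (if x < 1 - \<alpha> then x + \<alpha>
                 else if x < 1 - \<beta> then x + \<beta>
                 else x - 1 + \<beta>)"

definition U :: "(real \<times> real) set" where
  "U = {(\<alpha>, \<beta>). 0 < \<beta> \<and> \<beta> \<le> \<alpha> \<and> \<alpha> \<le> 1}"

definition G :: "real \<times> real \<Rightarrow> real \<times> real" where
  "G p = (snd p / fst p, (snd p - 1) / fst p + of_int \<lfloor>1 / fst p\<rfloor>)"

definition Omega_inf :: "(real \<times> real) set" where
  "Omega_inf = {p. \<forall>n. (G ^^ n) p \<in> interior U}"

definition Omega :: "real \<Rightarrow> real \<Rightarrow> real set" where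
  "Omega \<alpha> \<beta> = (\<Inter>n. closure ((T \<alpha> \<beta> ^^ n) ` {0..1}))"

definition inv_prob :: "real \<Rightarrow> real \<Rightarrow> real measure \<Rightarrow> bool" where
  "inv_prob \<alpha> \<beta> \<mu> \<longleftrightarrow> prob_space \<mu> \<and> sets \<mu> = sets borel \<and>
     emeasure \<mu> (Omega \<alpha> \<beta>) = 1 \<and> distr \<mu> borel (T \<alpha> \<beta>) = \<mu>"

definition is_eigenvalue :: "real \<Rightarrow> real \<Rightarrow> real measure \<Rightarrow> complex \<Rightarrow> bool" where
  "is_eigenvalue \<alpha> \<beta> \<mu> c \<longleftrightarrow>
     (\<exists>f :: real \<Rightarrow> complex. f \<in> borel_measurable \<mu> \<and>
        integrable \<mu> (\<lambda>x. (norm (f x))\<^sup>2) \<and>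
        \<not> (AE x in \<mu>. f x = 0) \<and>
        (AE x in \<mu>. f (T \<alpha> \<beta> x) = c * f x))"

text \<open>T has an eigenvalue lam: with respect to some invariant probability measure on Omega
  (for infinite type T is uniquely ergodic on Omega, so this is the unique one).\<close>
definition has_eigenvalue :: "real \<Rightarrow> real \<Rightarrow> complex \<Rightarrow> bool" where
  "has_eigenvalue \<alpha> \<beta> c \<longleftrightarrow> (\<exists>\<mu>. inv_prob \<alpha> \<beta> \<mu> \<and> is_eigenvalue \<alpha> \<beta> \<mu> c)"

end

theory Submission
  imports Defs
begin

text \<open>
  Along a \<^const>\<open>G\<close>-orbit the parameters satisfy the second order continued fraction
  $1/a_n = k_n + a_{n+1}(1 - a_{n+2})$ with digits $k_n = \lfloor 1/a_n \rfloor$. Every digit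
  sequence extends, and common digits force closeness, so it suffices to append a suitable
  block of digits to any finite block.

  Inducing on $[1 - \alpha, 1]$ codes orbits by the substitutions
  $1 \to 2$, $2 \to 3 1^k$, $3 \to 3 1^{k-1}$. Their incidence matrices are unimodular, so some digit
  makes the heights $h_1, h_2$ of the first two towers coprime, say $a h_1 = b h_2 + 1$. Two
  following digits much larger than all heights, chosen so that long runs of the first and of the
  second tower have the same length, and then the digit 1, make a fixed proportion of every orbit
  almost return after time $a h_1$, and another fixed proportion after time $b h_2$.
  If \<^term>\<open>f (T \<alpha> \<beta> x) = c * f x\<close>, then $c^{a h_1}$ and $c^{b h_2}$ are both close to 1, hence so is $c$.
  Generically this happens with arbitrary precision, by the Baire category theorem.
\<close>

section \<open>The parameter dynamics\<close>

text \<open>Eigenfunctions are only measurable, so almost returns carry information only if the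
  share of time they occupy is bounded below independently of the precision; here this share is 1/8.
  As |c| = 1, the function |f| is invariant, so a share of time along every orbit becomes the same
  share of the integral of |f|, whichever invariant measure is given. The return times depend on the
  precision, hence continuity of f in mean must hold uniformly over all measure-preserving maps; see
  \<open>almost_invariant\<close>.

  Equal lengths of the two runs prevent either share from being swamped by the other run. The final
  digit 1 makes every block of level n + 3 open with both runs, followed by at most one further
  block of level n + 1. Coprimality costs a single digit because the first two heights of the next
  level are h_2 and h_3 + k h_1 of the present one.\<close>

lemma interior_U: "interior U = {p. 0 < snd p \<and> snd p < fst p \<and> fst p < 1}" (is "_ = ?V")
proof
  show "interior U \<subseteq> ?V"
  proof
    fix p assume "p \<in> interior U"
    then obtain e where e: "e > 0" "ball p e \<subseteq> U"
      by (meson mem_interior)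
    obtain a b where p: "p = (a, b)" by (cases p)
    have "p \<in> ball p e" "(a, b + e/2) \<in> ball p e" "(a + e/2, b) \<in> ball p e"
      using e(1) by (auto simp: p dist_Pair_Pair dist_real_def)
    then have "p \<in> U" "(a, b + e/2) \<in> U" "(a + e/2, b) \<in> U"
      using e(2) by blast+
    then show "p \<in> ?V"
      using e(1) by (auto simp: p U_def)
  qed
  have "open ?V"
    by (intro open_Collect_conj open_Collect_less continuous_intros)
  moreover have "?V \<subseteq> U"
    by (auto simp: U_def)
  ultimately show "?V \<subseteq> interior U"
    by (rule interior_maximal[rotated])
qed

definition digit :: "real \<times> real \<Rightarrow> nat" where
  "digit p = nat \<lfloor>1 / fst p\<rfloor>"

definition par :: "real \<times> real \<Rightarrow> nat \<Rightarrow> real" where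
  "par p n = fst ((G ^^ n) p)"

lemma digit_bounds:
  assumes "p \<in> interior U"
  shows "digit p \<ge> 1" "real (digit p) * fst p \<le> 1" "1 < (real (digit p) + 1) * fst p"
    "of_int \<lfloor>1 / fst p\<rfloor> = real (digit p)"
proof -
  have a: "0 < fst p" "fst p < 1"
    using assms by (auto simp: interior_U)
  then have "1 / fst p > 1" by simp
  then have f: "\<lfloor>1 / fst p\<rfloor> \<ge> 1"
    by linarith
  then show eq: "of_int \<lfloor>1 / fst p\<rfloor> = real (digit p)"
    unfolding digit_def by (subst of_nat_nat) linarith+
  show "digit p \<ge> 1"
    using f unfolding digit_def by linarith
  have "real (digit p) \<le> 1 / fst p" "1 / fst p < real (digit p) + 1"
    unfolding eq[symmetric] by linarith+
  then show "real (digit p) * fst p \<le> 1" "1 < (real (digit p) + 1) * fst p"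
    using a by (simp_all add: field_simps)
qed

lemma Omega_infD:
  assumes "p \<in> Omega_inf"
  shows "(G ^^ n) p \<in> interior U" "(G ^^ n) p \<in> Omega_inf" "G p \<in> Omega_inf"
proof -
  show "(G ^^ n) p \<in> interior U"
    using assms by (simp add: Omega_inf_def)
  have *: "(G ^^ n) p \<in> Omega_inf" for n
    using assms unfolding Omega_inf_def
    by (simp flip: funpow_add comp_apply[of "G ^^ _" "G ^^ _" p] )
  show "(G ^^ n) p \<in> Omega_inf" "G p \<in> Omega_inf"
    using *[of n] *[of 1] by simp_all
qed

lemma Omega_inf_iff_G: "p \<in> Omega_inf \<longleftrightarrow> p \<in> interior U \<and> G p \<in> Omega_inf"
proof
  assume "p \<in> Omega_inf"
  then show "p \<in> interior U \<and> G p \<in> Omega_inf"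
    using Omega_infD(1)[of p 0] Omega_infD(3) by auto
next
  assume *: "p \<in> interior U \<and> G p \<in> Omega_inf"
  have "(G ^^ n) p \<in> interior U" for n
  proof (cases n)
    case (Suc m)
    then show ?thesis
      using Omega_infD(1)[of "G p" m] * by (simp add: funpow_swap1)
  qed (use * in auto)
  then show "p \<in> Omega_inf"
    by (simp add: Omega_inf_def)
qed

text \<open>The first coordinate of \<open>G\<close> says that the second parameter is a_n a_{n+1}.
  Substituting this into the second coordinate of \<open>G\<close> leaves a recursion in the numbers
  a_n alone.\<close>

lemma par_recursion:
  assumes "p \<in> Omega_inf"
  shows "0 < par p n" "par p n < 1" "snd ((G ^^ n) p) = par p n * par p (Suc n)"
    "1 / par p n = digit ((G ^^ n) p) + par p (Suc n) * (1 - par p (Suc (Suc n)))"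
proof -
  have i: "(G ^^ n) p \<in> interior U" for n
    using Omega_infD(1)[OF assms] .
  show 1: "0 < par p n" and "par p n < 1" for n
    using i[of n] by (auto simp: interior_U par_def)
  show 2: "snd ((G ^^ n) p) = par p n * par p (Suc n)" for n
    using 1[of n] by (simp add: par_def G_def)
  have "par p (Suc n) * par p (Suc (Suc n)) = snd ((G ^^ Suc n) p)"
    using 2[of "Suc n"] by simp
  also have "\<dots> = (snd ((G ^^ n) p) - 1) / par p n + digit ((G ^^ n) p)"
    using digit_bounds(4)[OF i[of n]] by (simp add: G_def par_def)
  also have "\<dots> = par p (Suc n) - 1 / par p n + digit ((G ^^ n) p)"
    using 1[of n] by (simp add: 2 diff_divide_distrib)
  finally show "1 / par p n = digit ((G ^^ n) p) + par p (Suc n) * (1 - par p (Suc (Suc n)))"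
    by (simp add: algebra_simps)
qed

text \<open>The partial derivatives of b (1 - c) have absolute values 1 - c and b, with sum at most
  k + b (1 - c) = 1/a because k \<ge> 1. The factor a a' from inverting turns the mean of 1/a and
  1/a' into the mean of a and a'. That mean may be close to 1, so the contraction is not
  uniform.\<close>

lemma par_contraction:
  fixes a b c a' b' c' k :: real
  assumes k: "1 \<le> k" and a: "0 < a" "0 < a'"
    and b: "0 \<le> b" "b \<le> 1" "0 \<le> b'" "b' \<le> 1" and c: "0 \<le> c" "c \<le> 1" "0 \<le> c'" "c' \<le> 1"
    and rec: "1 / a = k + b * (1 - c)" "1 / a' = k + b' * (1 - c')"
    and m: "\<bar>b - b'\<bar> \<le> m" "\<bar>c - c'\<bar> \<le> m"
  shows "\<bar>a - a'\<bar> \<le> (a + a') / 2 * m"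
proof -
  define P Q where "P = b * (1 - c)" and "Q = b' * (1 - c')"
  have m0: "0 \<le> m" using m(1) by linarith
  have "\<bar>P - Q\<bar> = \<bar>(b - b') * ((1 - c + (1 - c')) / 2) + (c' - c) * ((b + b') / 2)\<bar>"
    unfolding P_def Q_def by (rule arg_cong[where f = abs]) (simp add: field_simps)
  also have "\<dots> \<le> \<bar>b - b'\<bar> * ((1 - c + (1 - c')) / 2) + \<bar>c - c'\<bar> * ((b + b') / 2)"
    using b c by (intro order_trans[OF abs_triangle_ineq]) (simp add: abs_mult abs_minus_commute)
  also have "\<dots> \<le> m * ((1 - c + (1 - c')) / 2) + m * ((b + b') / 2)"
    using b c m by (intro add_mono mult_right_mono) auto
  also have "\<dots> = m * ((1 - c + (1 - c') + (b + b')) / 2)"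
    by (simp add: field_simps)
  also have "\<dots> \<le> m * ((1 / a + 1 / a') / 2)"
  proof (intro mult_left_mono divide_right_mono m0)
    have "0 \<le> (1 - b) * c" "0 \<le> (1 - b') * c'" using b c by simp_all
    then show "1 - c + (1 - c') + (b + b') \<le> 1 / a + 1 / a'"
      unfolding rec using k by (simp add: algebra_simps)
  qed simp
  finally have PQ: "\<bar>P - Q\<bar> \<le> m * ((1 / a + 1 / a') / 2)" .
  have "a - a' = a * a' * (1 / a' - 1 / a)"
    using a by (simp add: field_simps)
  also have "\<dots> = a * a' * (Q - P)"
    unfolding rec P_def Q_def by simp
  finally have "\<bar>a - a'\<bar> = a * a' * \<bar>P - Q\<bar>"
    using a by (simp add: abs_mult abs_minus_commute)
  also have "\<dots> \<le> a * a' * (m * ((1 / a + 1 / a') / 2))"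
    using a by (intro mult_left_mono PQ) simp
  also have "\<dots> = (a + a') / 2 * m"
    using a by (simp add: field_simps)
  finally show ?thesis .
qed

text \<open>Since $a + a' \le 2 - |a - a'|$ for $a, a' \le 1$, the previous lemma bounds an error $e$ by
  $(1 - e/2) m$, where $m$ is the larger of the next two errors; hence the harmonic decay.\<close>
lemma par_close:
  assumes p: "p \<in> Omega_inf" and q: "q \<in> Omega_inf"
    and eq: "\<And>j. j < i + 2 * m \<Longrightarrow> digit ((G ^^ j) p) = digit ((G ^^ j) q)"
  shows "\<bar>par p i - par q i\<bar> \<le> 2 / (2 + real m) \<and>
    \<bar>par p (Suc i) - par q (Suc i)\<bar> \<le> 2 / (2 + real m)"
  using eq
proof (induction m arbitrary: i)
  case 0
  have "\<bar>par p i - par q i\<bar> \<le> 1" for i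
    using par_recursion(1,2)[OF p, of i] par_recursion(1,2)[OF q, of i] by linarith
  then show ?case by simp
next
  case (Suc m)
  define s where "s = 2 / (2 + real m)"
  \<comment> \<open>Solving e \<le> (1 - e/2) s for e gives e \<le> s / (1 + s/2), and the numbers 2
    / (2 + m) are the orbit of 1 under s \<mapsto> s / (1 + s/2).\<close>
  have "2 / (c + 1) = (2 / c) / (1 + (2 / c) / 2)" if "c > 0" for c :: real
    using that by (simp add: divide_simps)
  from this[of "2 + real m"] have s0: "0 < s" and s_step: "2 / (2 + real (Suc m)) = s / (1 + s / 2)"
    by (simp_all add: s_def add_ac)
  have step: "\<bar>par p j - par q j\<bar> \<le> s / (1 + s / 2)"
    if d: "digit ((G ^^ j) p) = digit ((G ^^ j) q)"
    and 1: "\<bar>par p (Suc j) - par q (Suc j)\<bar> \<le> s"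
    and 2: "\<bar>par p (Suc (Suc j)) - par q (Suc (Suc j))\<bar> \<le> s" for j
  proof -
    note P = par_recursion[OF p] and Q = par_recursion[OF q]
    let ?e = "\<bar>par p j - par q j\<bar>"
    have "?e \<le> (par p j + par q j) / 2 * s"
    proof (rule par_contraction[OF _ _ _ _ _ _ _ _ _ _ _ P(4)])
      show "1 \<le> real (digit ((G ^^ j) p))"
        using digit_bounds(1)[OF Omega_infD(1)[OF p, of j]] by simp
      show "1 / par q j = real (digit ((G ^^ j) p)) + par q (Suc j) * (1 - par q (Suc (Suc j)))"
        unfolding d by (rule Q(4))
    qed (use P(1,2) Q(1,2) 1 2 in \<open>auto intro: less_imp_le\<close>)
    also have "\<dots> \<le> (1 - ?e / 2) * s"
      using P(2)[of j] Q(2)[of j] s0 by (intro mult_right_mono) (auto simp: abs_if field_simps)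
    finally have "?e * (1 + s / 2) \<le> s"
      by (simp add: algebra_simps)
    then show ?thesis
      using s0 by (simp add: pos_le_divide_eq)
  qed
  \<comment> \<open>The recursion looks two indices ahead, so each improvement of the bound uses up
    two digits. The error at i + 1 is improved before the error at i, which depends on it.\<close>
  have IH: "\<bar>par p (Suc (Suc i)) - par q (Suc (Suc i))\<bar> \<le> s"
    "\<bar>par p (Suc (Suc (Suc i))) - par q (Suc (Suc (Suc i)))\<bar> \<le> s"
    using Suc.IH[of "Suc (Suc i)"] Suc.prems by (auto simp: s_def)
  have 1: "\<bar>par p (Suc i) - par q (Suc i)\<bar> \<le> s / (1 + s / 2)"
    using step[OF Suc.prems IH] by simp
  also have "\<dots> \<le> s"
    using s0 by (simp add: field_simps)
  finally have "\<bar>par p i - par q i\<bar> \<le> s / (1 + s / 2)"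
    using step[of i] IH Suc.prems by simp
  then show ?case
    using 1 by (simp only: s_step)
qed

text \<open>Three times 2 / (2 + m): once for the first coordinate and twice for the second, which
  is a product of two numbers below 1.\<close>

lemma dist_le_of_digits:
  assumes p: "p \<in> Omega_inf" and q: "q \<in> Omega_inf"
    and eq: "\<And>j. j < 2 * m \<Longrightarrow> digit ((G ^^ j) p) = digit ((G ^^ j) q)"
  shows "dist p q \<le> 6 / (2 + real m)"
proof -
  let ?e = "2 / (2 + real m)"
  note P = par_recursion[OF p] and Q = par_recursion[OF q]
  have e: "\<bar>par p 0 - par q 0\<bar> \<le> ?e" "\<bar>par p 1 - par q 1\<bar> \<le> ?e"
    using par_close[OF p q, of 0 m] eq by auto
  have f: "fst p = par p 0" "fst q = par q 0"
    by (simp_all add: par_def)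
  have s: "snd p = par p 0 * par p 1" "snd q = par q 0 * par q 1"
    using P(3)[of 0] Q(3)[of 0] by simp_all
  have "snd p - snd q = par p 0 * (par p 1 - par q 1) + par q 1 * (par p 0 - par q 0)"
    by (simp add: s algebra_simps)
  then have "\<bar>snd p - snd q\<bar> \<le> par p 0 * \<bar>par p 1 - par q 1\<bar> + par q 1 * \<bar>par p 0 - par q 0\<bar>"
    using P(1)[of 0] Q(1)[of 1] by (metis abs_mult abs_of_pos abs_triangle_ineq)
  also have "\<dots> \<le> 1 * ?e + 1 * ?e"
    using P(1,2)[of 0] Q(1,2)[of 1] e by (intro add_mono mult_mono) auto
  finally have s': "\<bar>snd p - snd q\<bar> \<le> 2 * ?e" by simp
  have "dist p q \<le> \<bar>fst p - fst q\<bar> + \<bar>snd p - snd q\<bar>"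
    using sqrt_sum_squares_le_sum_abs[of "fst p - fst q" "snd p - snd q"]
    by (simp add: dist_prod_def dist_real_def)
  also have "\<dots> \<le> ?e + 2 * ?e"
    using e s' f by simp
  finally show ?thesis by simp
qed

section \<open>Realising prescribed digit blocks\<close>

text \<open>The inverse branch of \<open>G\<close> with digit k. For p = (a, a a') the difference
  \<open>fst p - snd p\<close> is a (1 - a'), so the denominator is the right-hand side of the
  recursion.\<close>

definition branch :: "nat \<Rightarrow> real \<times> real \<Rightarrow> real \<times> real" where
  "branch k p = (1 / (k + fst p - snd p), fst p / (k + fst p - snd p))"

text \<open>Since 0 < \<open>fst p - snd p\<close> < 1, the denominator lies strictly between k and
  k + 1. Hence every branch is defined on the whole interior of \<open>U\<close>, and successive
  digits do not restrict each other.\<close>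

lemma branch:
  assumes "p \<in> interior U" "k \<ge> 1"
  shows "branch k p \<in> interior U" "G (branch k p) = p" "digit (branch k p) = k"
proof -
  define s where "s = real k + fst p - snd p"
  have p: "0 < snd p" "snd p < fst p" "fst p < 1"
    using assms(1) by (auto simp: interior_U)
  have k: "1 \<le> real k" using assms(2) by simp
  then have s: "real k < s" "s < real k + 1" "1 < s"
    using p by (auto simp: s_def)
  then have f: "\<lfloor>s\<rfloor> = int k"
    by (auto simp: floor_eq_iff)
  have b: "branch k p = (1 / s, fst p / s)"
    by (simp add: branch_def s_def)
  show "branch k p \<in> interior U"
    using p s by (auto simp: b interior_U divide_simps)
  show "digit (branch k p) = k"
    using f by (simp add: b digit_def)
  have "(fst p / s - 1) * s = fst p - s"
    using s by (simp add: left_diff_distrib)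
  then have "(fst p / s - 1) * s + k = snd p"
    by (simp add: s_def)
  then show "G (branch k p) = p"
    using s by (simp add: G_def b f prod_eq_iff)
qed

text \<open>Provides a tail after which finite digit blocks can be completed. The point has all
  digits 2: it is the fixed point of \<open>branch 2\<close>, where 1/x = 2 + x (1 - x).\<close>

lemma Omega_inf_nonempty: "Omega_inf \<noteq> {}"
proof -
  have "\<exists>x\<ge>0. x \<le> 1/2 \<and> x^3 - x^2 - 2 * x + 1 = (0::real)"
    by (rule IVT2) (auto simp: power2_eq_square power3_eq_cube)
  then obtain x :: real where x: "0 \<le> x" "x \<le> 1/2" and eq: "x^3 - x^2 - 2 * x + 1 = 0"
    by auto
  have "x \<noteq> 0"
    using eq by auto
  moreover have "x \<noteq> 1 / 2"
  proof
    assume h: "x = 1 / 2"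
    show False
      using eq unfolding h by (simp add: power2_eq_square power3_eq_cube)
  qed
  ultimately have x': "0 < x" "x < 1/2" using x by auto
  have s: "x * (2 + x - x^2) = 1"
    using eq by (simp add: algebra_simps power2_eq_square power3_eq_cube)
  define p where "p = (x, x^2)"
  have "x^2 < x" using x' by (simp add: power2_eq_square)
  then have p: "p \<in> interior U"
    using x' by (auto simp: p_def interior_U)
  have "2 + x - x^2 = 1 / x"
    using s x' by (simp add: field_simps)
  then have "branch 2 p = p"
    using x' by (simp add: branch_def p_def power2_eq_square)
  then have "G p = p"
    using branch(2)[OF p, of 2] by simp
  then have "(G ^^ n) p = p" for n
    by (induction n) auto
  then have "p \<in> Omega_inf"
    using p by (simp add: Omega_inf_def)
  then show ?thesis by blast
qed

lemma branches:
  assumes "p \<in> Omega_inf" "\<forall>k\<in>set ks. k \<ge> 1"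
  shows "\<exists>q\<in>Omega_inf. (\<forall>j<length ks. digit ((G ^^ j) q) = ks ! j)"
proof -
  have "foldr branch ks p \<in> Omega_inf \<and> (\<forall>j<length ks. digit ((G ^^ j) (foldr branch ks p)) = ks ! j)"
    using assms(2)
  proof (induction ks)
    case Nil
    then show ?case using assms(1) by simp
  next
    case (Cons k ks)
    define q where "q = foldr branch ks p"
    have IH: "q \<in> Omega_inf" "\<forall>j<length ks. digit ((G ^^ j) q) = ks ! j"
      using Cons by (auto simp: q_def)
    have q: "q \<in> interior U" using Omega_infD(1)[OF IH(1), of 0] by simp
    have b: "branch k q \<in> interior U" "G (branch k q) = q" "digit (branch k q) = k"
      using branch[OF q] Cons.prems by auto
    have "digit ((G ^^ j) (branch k q)) = (k # ks) ! j" if "j < length (k # ks)" for j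
      using that b IH(2) by (cases j) (auto simp: funpow_swap1)
    moreover have "branch k q \<in> Omega_inf"
      using b IH(1) Omega_inf_iff_G by metis
    ultimately show ?case by (simp add: q_def)
  qed
  then show ?thesis by blast
qed

section \<open>Local constancy of digits\<close>

text \<open>The floor jumps only where \<open>1 / fst p\<close> is an integer. There both
  coordinates of \<open>G p\<close> coincide, so \<open>G p\<close> is not in the interior of
  \<open>U\<close>.\<close>

lemma isCont_G:
  assumes "p \<in> interior U" "G p \<in> interior U"
  shows "\<forall>\<^sub>F q in nhds p. digit q = digit p" "isCont G p"
proof -
  have p: "0 < snd p" "snd p < fst p" "fst p < 1"
    using assms(1) by (auto simp: interior_U)
  define k where "k = \<lfloor>1 / fst p\<rfloor>"
  have "snd (G p) < fst (G p)"
    using assms(2) by (auto simp: interior_U)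
  then have "of_int k \<noteq> 1 / fst p"
    unfolding G_def k_def[symmetric] by (auto simp: diff_divide_distrib)
  then have k: "of_int k < 1 / fst p" "1 / fst p < of_int k + 1"
    unfolding k_def by linarith+
  have lim: "((\<lambda>q. 1 / fst q) \<longlongrightarrow> 1 / fst p) (nhds p)"
    using p by (intro tendsto_intros filterlim_ident) auto
  have "\<forall>\<^sub>F q in nhds p. of_int k < 1 / fst q \<and> 1 / fst q < of_int k + 1"
    by (intro eventually_conj order_tendstoD[OF lim] k)
  then have ev: "\<forall>\<^sub>F q in nhds p. \<lfloor>1 / fst q\<rfloor> = k"
    by (rule eventually_mono) (simp add: floor_eq_iff)
  then show "\<forall>\<^sub>F q in nhds p. digit q = digit p"
    by (rule eventually_mono) (simp add: digit_def k_def)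
  have "\<forall>\<^sub>F q in nhds p. G q = (snd q / fst q, (snd q - 1) / fst q + of_int k)"
    using ev by (rule eventually_mono) (simp add: G_def)
  moreover have "isCont (\<lambda>q. (snd q / fst q, (snd q - 1) / fst q + of_int k)) p"
    using p by (intro continuous_intros) auto
  ultimately show "isCont G p"
    by (subst isCont_cong)
qed

lemma isCont_funpow_G:
  assumes "\<And>i. i \<le> n \<Longrightarrow> (G ^^ i) p \<in> interior U"
  shows "isCont (G ^^ n) p"
  using assms
proof (induction n)
  case 0
  then show ?case by (simp add: id_def)
next
  case (Suc n)
  have "isCont G ((G ^^ n) p)"
    using Suc.prems[of n] Suc.prems[of "Suc n"] by (intro isCont_G) auto
  then have "isCont (G \<circ> (G ^^ n)) p"
    using Suc by (intro continuous_at_compose) auto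
  then show ?case by (simp add: comp_def)
qed

lemma eventually_digit_eq:
  assumes "p \<in> Omega_inf"
  shows "\<forall>\<^sub>F q in nhds p. \<forall>i\<le>n. digit ((G ^^ i) q) = digit ((G ^^ i) p)"
proof -
  have "\<forall>\<^sub>F q in nhds p. digit ((G ^^ i) q) = digit ((G ^^ i) p)" for i
  proof -
    have "((G ^^ i) \<longlongrightarrow> (G ^^ i) p) (nhds p)"
      using isCont_funpow_G[of i p] Omega_infD(1)[OF assms]
      by (simp add: isCont_def tendsto_at_iff_tendsto_nhds)
    moreover have "\<forall>\<^sub>F q in nhds ((G ^^ i) p). digit q = digit ((G ^^ i) p)"
      using isCont_G(1)[of "(G ^^ i) p"] Omega_infD(1)[OF assms, of i] Omega_infD(1)[OF assms, of "Suc i"] by simp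
    ultimately show ?thesis
      by (rule eventually_compose_filterlim[rotated])
  qed
  then have "\<forall>\<^sub>F q in nhds p. \<forall>i\<in>{..n}. digit ((G ^^ i) q) = digit ((G ^^ i) p)"
    by (intro eventually_ball_finite) auto
  then show ?thesis
    by (rule eventually_mono) auto
qed

text \<open>Gives the complete metrizability on which the category argument rests. The stages are
  open although \<open>G\<close> is discontinuous, because at a point of stage n the iterates up to
  n are continuous.\<close>

lemma gdelta_Omega_inf: "gdelta_in euclidean Omega_inf"
proof -
  define E where "E n = {p. \<forall>i\<le>n. (G ^^ i) p \<in> interior U}" for n
  have "open (E n)" for n
  proof (subst open_subopen, intro ballI)
    fix p assume p: "p \<in> E n"
    have "\<forall>\<^sub>F q in nhds p. (G ^^ i) q \<in> interior U" if "i \<le> n" for i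
    proof -
      have "isCont (G ^^ i) p"
        using p that by (intro isCont_funpow_G) (auto simp: E_def)
      then have "((G ^^ i) \<longlongrightarrow> (G ^^ i) p) (nhds p)"
        by (simp add: isCont_def tendsto_at_iff_tendsto_nhds)
      then show ?thesis
        using p that by (intro topological_tendstoD) (auto simp: E_def)
    qed
    then have "\<forall>\<^sub>F q in nhds p. \<forall>i\<in>{..n}. (G ^^ i) q \<in> interior U"
      by (intro eventually_ball_finite) auto
    then show "\<exists>V. open V \<and> p \<in> V \<and> V \<subseteq> E n"
      by (auto simp: eventually_nhds E_def)
  qed
  then have "gdelta_in euclidean (\<Inter>n. E n)"
    by (intro gdelta_in_Inter) (auto intro: open_imp_gdelta_in)
  moreover have "(\<Inter>n. E n) = Omega_inf"
    by (auto simp: E_def Omega_inf_def)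
  ultimately show ?thesis by simp
qed

section \<open>Symbolic coding of the first return maps\<close>

abbreviation Tmap :: "real \<times> real \<Rightarrow> real \<Rightarrow> real" where
  "Tmap p \<equiv> T (fst p) (snd p)"

definition letter :: "real \<times> real \<Rightarrow> real \<Rightarrow> nat" where
  "letter p x = (if x < 1 - fst p then 1 else if x < 1 - snd p then 2 else 3)"

primrec follows :: "real \<times> real \<Rightarrow> real \<Rightarrow> nat list \<Rightarrow> bool" where
  "follows p x [] \<longleftrightarrow> True"
| "follows p x (s # v) \<longleftrightarrow> letter p x = s \<and> follows p (Tmap p x) v"

definition return_word :: "nat \<Rightarrow> nat \<Rightarrow> nat list" where
  "return_word k s = (if s = 1 then [2] else 3 # replicate (if s = 2 then k else k - 1) 1)"

text \<open>A picture of towers: they stand over the three letter intervals of q, embedded by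
  \<phi>, and w spells the p-letters met while climbing until the base is reached again.\<close>

definition coded ::
  "real \<times> real \<Rightarrow> (real \<Rightarrow> real) \<Rightarrow> real \<times> real \<Rightarrow> (nat \<Rightarrow> nat list) \<Rightarrow> bool" where
  "coded p \<phi> q w \<longleftrightarrow> (\<forall>y\<in>{0..1}. \<phi> y \<in> {0..1} \<and> follows p (\<phi> y) (w (letter q y)) \<and>
     (Tmap p ^^ length (w (letter q y))) (\<phi> y) = \<phi> (Tmap q y))"

lemma T_in_unit:
  assumes "p \<in> interior U" "x \<in> {0..1}"
  shows "Tmap p x \<in> {0..1}"
  using assms by (auto simp: interior_U T_def)

lemma funpow_T_in_unit:
  assumes "p \<in> interior U" "x \<in> {0..1}"
  shows "(Tmap p ^^ n) x \<in> {0..1}"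
  by (induction n) (use assms T_in_unit in auto)

lemma follows_append:
  "follows p x (u @ v) \<longleftrightarrow> follows p x u \<and> follows p ((Tmap p ^^ length u) x) v"
  by (induction u arbitrary: x) (auto simp: funpow_swap1)

lemma T_diff:
  assumes "letter p x = letter p y"
  shows "Tmap p x - Tmap p y = x - y"
  using assms by (auto simp: letter_def T_def split: if_splits)

lemma funpow_T_diff:
  assumes "follows p x v" "follows p y v" "j \<le> length v"
  shows "(Tmap p ^^ j) x - (Tmap p ^^ j) y = x - y"
  using assms
proof (induction v arbitrary: x y j)
  case (Cons s v)
  have "(Tmap p ^^ i) (Tmap p x) - (Tmap p ^^ i) (Tmap p y) = x - y" if "i \<le> length v" for i
    using Cons.IH[of "Tmap p x" "Tmap p y" i] Cons.prems T_diff[of p x y] that by simp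
  then show ?case
    using Cons.prems(3) by (cases j) (auto simp: funpow_swap1)
qed simp

lemma T_of_letter_1: "letter p x = 1 \<Longrightarrow> Tmap p x = x + fst p"
  by (auto simp: letter_def T_def split: if_splits)

lemma follows_ones:
  assumes "follows p x (replicate r 1)" "i \<le> r"
  shows "(Tmap p ^^ i) x = x + i * fst p" "i < r \<Longrightarrow> letter p ((Tmap p ^^ i) x) = 1"
proof -
  show 1: "i < r \<Longrightarrow> letter p ((Tmap p ^^ i) x) = 1" for i
    using assms(1)
  proof (induction r arbitrary: x i)
    case (Suc r)
    then show ?case by (cases i) (auto simp: funpow_swap1)
  qed simp
  show "(Tmap p ^^ i) x = x + i * fst p"
    using assms(2)
  proof (induction i)
    case (Suc i)
    then have "letter p ((Tmap p ^^ i) x) = 1" "(Tmap p ^^ i) x = x + i * fst p"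
      using 1[of i] by auto
    then show ?case using T_of_letter_1[of p "x + i * fst p"] by (simp add: algebra_simps)
  qed simp
qed

lemma follows_onesI:
  assumes "0 \<le> fst p" "x + real r * fst p < 1"
  shows "follows p x (replicate r 1)"
  using assms
proof (induction r arbitrary: x)
  case (Suc r)
  have "0 \<le> real r * fst p" using Suc.prems by simp
  then have "x < 1 - fst p" using Suc.prems(2) by (simp add: algebra_simps)
  moreover from this have "Tmap p x = x + fst p" by (simp add: T_def)
  moreover have "x + fst p + real r * fst p < 1" using Suc.prems(2) by (simp add: algebra_simps)
  ultimately show ?case using Suc by (simp add: letter_def)
qed simp

text \<open>The first return map of \<^term>\<open>Tmap p\<close> to $[1 - \alpha, 1]$ is, after rescaling, the map with
  parameters \<^term>\<open>G p\<close>.\<close>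
lemma coded_G:
  assumes p: "p \<in> interior U" and q: "G p \<in> interior U"
  shows "coded p (\<lambda>y. 1 - fst p + fst p * y) (G p) (return_word (digit p))"
  unfolding coded_def
proof
  fix y :: real assume y: "y \<in> {0..1}"
  define a b k where "a = fst p" and "b = snd p" and "k = real (digit p)"
  define x where "x = 1 - a + a * y"
  have p': "0 < b" "b < a" "a < 1"
    using p by (auto simp: interior_U a_def b_def)
  have k: "1 \<le> k" "k * a \<le> 1" "1 < (k + 1) * a" "k \<ge> 0"
    using digit_bounds[OF p] by (auto simp: k_def a_def)
  have Gp: "G p = (b / a, (b - 1) / a + k)"
    using digit_bounds(4)[OF p] by (simp add: G_def a_def b_def k_def)
  have ay: "0 \<le> a * y" "a * y \<le> a"
    using y p' by (auto simp: mult_left_le)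
  then have x: "1 - a \<le> x" "x \<le> 1"
    using p' by (auto simp: x_def)
  \<comment> \<open>In the coordinate x = 1 - a + a y the break points become 1 - b, where the map
    wraps around, and 2 - b - k a, from which on k steps of length a after the wrap no longer stay
    below 1.\<close>
  have G1: "a * fst (G p) = b" "a * snd (G p) = b - 1 + k * a"
    using p' by (simp_all add: Gp field_simps)
  have "follows p x (return_word (digit p) (letter (G p) y)) \<and>
    (Tmap p ^^ length (return_word (digit p) (letter (G p) y))) x = 1 - a + a * Tmap (G p) y"
  proof (cases "y < 1 - fst (G p)")
    case True
    then have "a * y < a * (1 - fst (G p))" using p' by simp
    then have "x < 1 - b" by (simp add: x_def right_diff_distrib G1)
    with True x show ?thesis
      by (simp add: letter_def return_word_def T_def a_def[symmetric] b_def[symmetric] x_def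
          right_diff_distrib distrib_left G1)
  next
    case False
    then have "a * y \<ge> a * (1 - fst (G p))" using p' by simp
    then have xb: "x \<ge> 1 - b" by (simp add: x_def right_diff_distrib G1)
    define z where "z = x - 1 + b"
    have Tx: "Tmap p x = z" and lx: "letter p x = 3"
      using xb p' by (simp_all add: T_def letter_def z_def a_def[symmetric] b_def[symmetric])
    show ?thesis
    proof (cases "y < 1 - snd (G p)")
      case True
      then have "a * y < a * (1 - snd (G p))" using p' by simp
      then have "z + k * a < 1" by (simp add: z_def x_def right_diff_distrib G1)
      then have f: "follows p z (replicate (digit p) 1)"
        using p' by (intro follows_onesI) (auto simp: k_def a_def)
      have "(Tmap p ^^ digit p) z = z + k * a"
        using follows_ones(1)[OF f order_refl] by (simp add: k_def a_def)
      moreover have "z + k * a = 1 - a + a * Tmap (G p) y"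
        using True False by (simp add: T_def z_def x_def distrib_left G1)
      ultimately show ?thesis
        using True False f Tx lx by (simp add: letter_def return_word_def funpow_swap1)
    next
      case F2: False
      have k1: "real (digit p - 1) = k - 1"
        using k(1) by (simp add: k_def)
      have "z + (k - 1) * a < 1"
        using x k p' by (simp add: z_def algebra_simps)
      then have f: "follows p z (replicate (digit p - 1) 1)"
        using p' by (intro follows_onesI) (simp_all only: k1 a_def)
      have "(Tmap p ^^ (digit p - 1)) z = z + (k - 1) * a"
        using follows_ones(1)[OF f order_refl] by (simp only: k1 a_def)
      moreover have "z + (k - 1) * a = 1 - a + a * Tmap (G p) y"
        using F2 False by (simp add: T_def z_def x_def distrib_left right_diff_distrib G1)
          (simp add: algebra_simps)
      ultimately show ?thesis
        using F2 False f Tx lx by (simp add: letter_def return_word_def funpow_swap1)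
    qed
  qed
  moreover have "x \<in> {0..1}" using x p' by auto
  ultimately show "1 - fst p + fst p * y \<in> {0..1} \<and>
    follows p (1 - fst p + fst p * y) (return_word (digit p) (letter (G p) y)) \<and>
    (Tmap p ^^ length (return_word (digit p) (letter (G p) y))) (1 - fst p + fst p * y) =
    1 - fst p + fst p * Tmap (G p) y"
    unfolding x_def a_def by blast
qed

lemma codedD:
  assumes "coded p \<phi> q w" "y \<in> {0..1}"
  shows "\<phi> y \<in> {0..1}" "follows p (\<phi> y) (w (letter q y))"
    "(Tmap p ^^ length (w (letter q y))) (\<phi> y) = \<phi> (Tmap q y)"
  using assms by (auto simp: coded_def)

lemma coded_concat:
  assumes c: "coded p \<phi> q w" and q: "q \<in> interior U" and y: "y \<in> {0..1}" and u: "follows q y u"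
  shows "follows p (\<phi> y) (concat (map w u)) \<and>
    (Tmap p ^^ length (concat (map w u))) (\<phi> y) = \<phi> ((Tmap q ^^ length u) y)"
  using y u
proof (induction u arbitrary: y)
  case (Cons s u)
  then have s: "letter q y = s" and u: "follows q (Tmap q y) u" by auto
  note IH = Cons.IH[OF T_in_unit[OF q Cons.prems(1)] u]
  note D = codedD[OF c Cons.prems(1), unfolded s]
  show ?case
    using IH D by (simp add: follows_append funpow_add funpow_swap1 add.commute[of "length (w s)"])
qed simp

lemma coded_comp:
  assumes "coded p \<phi> q w" "q \<in> interior U" "coded q \<psi> r v"
  shows "coded p (\<phi> \<circ> \<psi>) r (\<lambda>s. concat (map w (v s)))"
  unfolding coded_def
proof
  fix y :: real assume y: "y \<in> {0..1}"
  note D = codedD[OF assms(3) y]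
  show "(\<phi> \<circ> \<psi>) y \<in> {0..1} \<and> follows p ((\<phi> \<circ> \<psi>) y) (concat (map w (v (letter r y)))) \<and>
    (Tmap p ^^ length (concat (map w (v (letter r y))))) ((\<phi> \<circ> \<psi>) y) = (\<phi> \<circ> \<psi>) (Tmap r y)"
    using coded_concat[OF assms(1,2) D(1,2)] codedD(1)[OF assms(1) D(1)] D(3) by simp
qed

primrec Phi :: "real \<times> real \<Rightarrow> nat \<Rightarrow> real \<Rightarrow> real" where
  "Phi p 0 = (\<lambda>y. y)"
| "Phi p (Suc n) = Phi p n \<circ> (\<lambda>y. 1 - par p n + par p n * y)"

definition digits :: "real \<times> real \<Rightarrow> nat \<Rightarrow> nat" where
  "digits p n = digit ((G ^^ n) p)"

primrec word :: "(nat \<Rightarrow> nat) \<Rightarrow> nat \<Rightarrow> nat \<Rightarrow> nat list" where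
  "word d 0 s = [s]"
| "word d (Suc n) s = concat (map (word d n) (return_word (d n) s))"

definition height :: "(nat \<Rightarrow> nat) \<Rightarrow> nat \<Rightarrow> nat \<Rightarrow> nat" where
  "height d n s = length (word d n s)"

lemma coded_step:
  assumes "p \<in> Omega_inf"
  shows "coded ((G ^^ n) p) (\<lambda>y. 1 - par p n + par p n * y) ((G ^^ Suc n) p) (return_word (digits p n))"
  using coded_G[of "(G ^^ n) p"] Omega_infD(1)[OF assms, of n] Omega_infD(1)[OF assms, of "Suc n"]
  by (simp add: par_def digits_def)

lemma coded_Phi:
  assumes "p \<in> Omega_inf"
  shows "coded p (Phi p n) ((G ^^ n) p) (word (digits p) n)"
proof (induction n)
  case 0
  then show ?case
    using T_in_unit Omega_infD(1)[OF assms, of 0] by (auto simp: coded_def)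
next
  case (Suc n)
  have "word (digits p) (Suc n) = (\<lambda>s. concat (map (word (digits p) n) (return_word (digits p n) s)))"
    by (rule ext) simp
  then show ?case
    using coded_comp[OF Suc Omega_infD(1)[OF assms] coded_step[OF assms]] by (simp only: Phi.simps)
qed

lemma Phi_diff:
  assumes "p \<in> Omega_inf"
  shows "\<bar>Phi p n x - Phi p n y\<bar> \<le> \<bar>x - y\<bar>"
proof (induction n arbitrary: x y)
  case (Suc n)
  note P = par_recursion(1,2)[OF assms, of n]
  have "\<bar>Phi p (Suc n) x - Phi p (Suc n) y\<bar> \<le> \<bar>par p n * (x - y)\<bar>"
    using Suc[of "1 - par p n + par p n * x" "1 - par p n + par p n * y"]
    by (simp add: right_diff_distrib)
  also have "\<dots> \<le> 1 * \<bar>x - y\<bar>"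
    using P unfolding abs_mult by (intro mult_right_mono) auto
  finally show ?case by simp
qed simp

section \<open>Arithmetic of the tower heights\<close>

lemma height_0 [simp]: "height d 0 s = 1"
  by (simp add: height_def)

lemma height_Suc [simp]:
  "height d (Suc n) (Suc 0) = height d n 2"
  "height d (Suc n) 2 = height d n 3 + d n * height d n 1"
  "height d (Suc n) 3 = height d n 3 + (d n - 1) * height d n 1"
  by (simp_all add: height_def return_word_def length_concat comp_def sum_list_replicate)

lemma height_pos: "0 < height d n s"
proof (induction n arbitrary: s)
  case (Suc n)
  have "height d (Suc n) s = (\<Sum>t\<leftarrow>return_word (d n) s. height d n t)"
    by (simp add: height_def length_concat comp_def)
  then show ?case
    using Suc[of 2] Suc[of 3] by (auto simp: return_word_def)
qed simp

lemma height_cong: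
  assumes "\<And>i. i < n \<Longrightarrow> d i = d' i"
  shows "height d n s = height d' n s"
proof -
  have "word d n s = word d' n s"
    using assms
  proof (induction n arbitrary: s)
    case (Suc n)
    then have "word d n = word d' n" by (intro ext) auto
    then show ?case using Suc.prems[of n] by simp
  qed simp
  then show ?thesis by (simp add: height_def)
qed

text \<open>A common divisor of the heights at one level descends to the level below: the second
  minus the third height is the lower \<open>height d n 1\<close>, the third then yields
  \<open>height d n 3\<close>, and the first is \<open>height d n 2\<close>.\<close>

lemma gcd_heights:
  assumes "\<And>i. i < n \<Longrightarrow> d i \<ge> 1"
  shows "gcd (height d n 1) (gcd (height d n 2) (height d n 3)) = 1"
  using assms
proof (induction n)
  case (Suc n)
  let ?h = "height d n"
  obtain k where k: "d n = Suc k"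
    using Suc.prems[of n] by (cases "d n") auto
  define g where "g = gcd (?h 2) (gcd (?h 3 + d n * ?h 1) (?h 3 + (d n - 1) * ?h 1))"
  have "g dvd ?h 2" "g dvd ?h 3 + d n * ?h 1" "g dvd ?h 3 + (d n - 1) * ?h 1"
    unfolding g_def
    by (rule gcd_dvd1, rule dvd_trans[OF gcd_dvd2 gcd_dvd1], rule dvd_trans[OF gcd_dvd2 gcd_dvd2])
  then have g: "g dvd ?h 2" "g dvd ?h 3 + k * ?h 1" "g dvd (?h 3 + k * ?h 1) + ?h 1"
    by (simp_all add: k add_ac)
  then have g1: "g dvd ?h 1"
    using dvd_add_right_iff[OF g(2)] by simp
  then have "g dvd ?h 3"
    using g(2) dvd_add_left_iff[of g "k * ?h 1" "?h 3"] by simp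
  then have "g dvd gcd (?h 1) (gcd (?h 2) (?h 3))"
    using g g1 by (intro gcd_greatest) auto
  moreover have "gcd (?h 1) (gcd (?h 2) (?h 3)) = 1"
    using Suc.IH Suc.prems by simp
  ultimately have "g dvd 1" by (simp only:)
  then show ?case by (simp add: g_def)
qed simp

text \<open>Let k be the product of the primes dividing h2 but not h3. A prime divisor of h2 then
  divides exactly one of h3 and k h1: if it divides h3, it divides neither k nor, by the gcd
  condition, h1.\<close>

lemma exists_coprime_shift:
  fixes h1 h2 h3 :: nat
  assumes g: "gcd h1 (gcd h2 h3) = 1" and h2: "h2 > 0"
  shows "\<exists>k\<ge>1. coprime h2 (h3 + k * h1)"
proof -
  define S where "S = {r \<in> prime_factors h2. \<not> r dvd h3}"
  define k where "k = \<Prod>S"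
  have S: "finite S" "\<And>r. r \<in> S \<Longrightarrow> prime r"
    by (auto simp: S_def)
  have "0 \<notin> S" using S(2)[of 0] by auto
  then have "k \<ge> 1"
    using S(1) unfolding k_def by (metis One_nat_def Suc_leI neq0_conv prod_zero_iff)
  moreover have "coprime h2 (h3 + k * h1)"
  proof (rule ccontr)
    assume "\<not> coprime h2 (h3 + k * h1)"
    then obtain r where r: "prime r" "r dvd h2" "r dvd h3 + k * h1"
      by (meson coprime_iff_gcd_eq_1 gcd_nat.bounded_iff prime_factor_nat)
    have rf: "r \<in> prime_factors h2"
      using r h2 by (simp add: prime_factors_dvd)
    show False
    proof (cases "r dvd h3")
      case True
      then have "r dvd k * h1" using r(3) dvd_add_right_iff by blast
      moreover have "\<not> r dvd h1"
      proof
        assume "r dvd h1"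
        then have "r dvd gcd h1 (gcd h2 h3)" using True r(2) by simp
        then show False using g r(1) by simp
      qed
      ultimately have "r dvd k" using r(1) prime_dvd_mult_nat by blast
      then obtain s where "s \<in> S" "r dvd s"
        using S(1) r(1) unfolding k_def by (auto simp: prime_dvd_prod_iff)
      then have "r \<in> S" using S(2) r(1) primes_dvd_imp_eq by metis
      then show False using True by (simp add: S_def)
    next
      case False
      then have "r \<in> S" using rf by (simp add: S_def)
      then have "r dvd k" unfolding k_def using S(1) by (rule dvd_prodI[rotated])
      then have "r dvd h3" using r(3) by (meson dvd_add_left_iff dvd_mult2)
      then show False using False by simp
    qed
  qed
  ultimately show ?thesis by blast
qed

section \<open>Almost periods along runs and entry into the base\<close>

text \<open>During a run of letter 1 the orbit climbs the same tower repeatedly, and a h steps later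
  it is at the same level, a climbs further. Climbing is a translation, so the displacement equals
  that of the base points; it is at most a \<open>fst q\<close>, since the induced map adds
  \<open>fst q\<close> on letter 1 and \<phi> does not expand.\<close>

lemma coded_run:
  assumes c: "coded p \<phi> q w" and q: "q \<in> interior U" and y: "y \<in> {0..1}"
    and contr: "\<And>u v. \<bar>\<phi> u - \<phi> v\<bar> \<le> \<bar>u - v\<bar>"
    and f: "follows q y (replicate r 1)" and h: "h = length (w 1)" and \<tau>: "\<tau> < (r - a) * h"
  shows "\<bar>(Tmap p ^^ (a * h)) ((Tmap p ^^ \<tau>) (\<phi> y)) - (Tmap p ^^ \<tau>) (\<phi> y)\<bar> \<le> a * fst q"
proof -
  have h0: "h > 0" using \<tau> by (cases h) auto
  define i j where "i = \<tau> div h" and "j = \<tau> mod h"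
  have ij: "\<tau> = j + i * h" "j < h"
    using h0 by (auto simp: i_def j_def)
  have i: "i < r - a"
    unfolding i_def using \<tau> h0 by (simp add: less_mult_imp_div_less)
  have jump: "(Tmap p ^^ (m * h)) (\<phi> y) = \<phi> ((Tmap q ^^ m) y)" if "m \<le> r" for m
  proof -
    have "follows q y (replicate m 1)"
      using f that by (metis follows_append le_add_diff_inverse replicate_add)
    from coded_concat[OF c q y this] show ?thesis
      by (simp add: length_concat comp_def sum_list_replicate h)
  qed
  have flw: "follows p (\<phi> ((Tmap q ^^ m) y)) (w 1)" if "m < r" for m
    using codedD(2)[OF c funpow_T_in_unit[OF q y], of m] follows_ones(2)[OF f _ that] that by simp
  have E1: "(Tmap p ^^ \<tau>) (\<phi> y) = (Tmap p ^^ j) (\<phi> ((Tmap q ^^ i) y))"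
    using jump[of i] i by (simp add: ij(1) funpow_add)
  have "a * h + \<tau> = j + (i + a) * h"
    by (simp add: ij(1) algebra_simps)
  then have E2: "(Tmap p ^^ (a * h)) ((Tmap p ^^ \<tau>) (\<phi> y)) =
      (Tmap p ^^ j) (\<phi> ((Tmap q ^^ (i + a)) y))"
    using jump[of "i + a"] i by (metis comp_apply funpow_add less_diff_conv less_imp_le)
  have "(Tmap p ^^ j) (\<phi> ((Tmap q ^^ (i + a)) y)) - (Tmap p ^^ j) (\<phi> ((Tmap q ^^ i) y)) =
      \<phi> ((Tmap q ^^ (i + a)) y) - \<phi> ((Tmap q ^^ i) y)"
    using i ij(2) by (intro funpow_T_diff[OF flw flw]) (auto simp: h)
  moreover have "\<bar>\<dots>\<bar> \<le> \<bar>(Tmap q ^^ (i + a)) y - (Tmap q ^^ i) y\<bar>"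
    by (rule contr)
  moreover have "(Tmap q ^^ (i + a)) y - (Tmap q ^^ i) y = a * fst q"
    using follows_ones(1)[OF f, of "i + a"] follows_ones(1)[OF f, of i] i by (simp add: algebra_simps)
  moreover have "0 \<le> a * fst q"
    using q by (auto simp: interior_U)
  ultimately show ?thesis
    unfolding E2 unfolding E1 by linarith
qed

text \<open>Below 1 - \<alpha> each step adds \<alpha>, and (k + 1) \<alpha> > 1 for the digit
  k.\<close>

lemma reach_induced:
  assumes p: "p \<in> interior U" and x: "x \<in> {0..1}"
  shows "\<exists>m\<le>digit p. \<exists>y\<in>{0..1}. (Tmap p ^^ m) x = 1 - fst p + fst p * y"
proof -
  have a: "0 < fst p" using p by (auto simp: interior_U)
  have *: "(\<exists>i<m. (Tmap p ^^ i) x \<ge> 1 - fst p) \<or> (Tmap p ^^ m) x = x + m * fst p" for m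
  proof (induction m)
    case (Suc m)
    then show ?case
      by (cases "(Tmap p ^^ m) x \<ge> 1 - fst p") (auto simp: T_def algebra_simps intro: less_SucI)
  qed simp
  have "\<exists>m\<le>digit p. (Tmap p ^^ m) x \<ge> 1 - fst p"
    using *[of "digit p"]
  proof
    assume "(Tmap p ^^ digit p) x = x + digit p * fst p"
    then have "(Tmap p ^^ digit p) x \<ge> 1 - fst p"
      using digit_bounds(3)[OF p] x by (simp add: algebra_simps)
    then show ?thesis by blast
  qed (auto intro: less_imp_le)
  then obtain m where m: "m \<le> digit p" "(Tmap p ^^ m) x \<ge> 1 - fst p" by blast
  define y where "y = ((Tmap p ^^ m) x - (1 - fst p)) / fst p"
  have "(Tmap p ^^ m) x = 1 - fst p + fst p * y"
    using a by (simp add: y_def)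
  moreover have "y \<in> {0..1}"
    using a m(2) funpow_T_in_unit[OF p x, of m] by (simp add: y_def)
  ultimately show ?thesis using m(1) by blast
qed

lemma coded_funpow:
  assumes c: "coded p \<phi> q w" and q: "q \<in> interior U" and y: "y \<in> {0..1}"
    and H: "\<And>s. s \<in> {1,2,3} \<Longrightarrow> length (w s) \<le> H"
  shows "\<exists>m\<le>i * H. (Tmap p ^^ m) (\<phi> y) = \<phi> ((Tmap q ^^ i) y)"
proof (induction i)
  case (Suc i)
  then obtain m where m: "m \<le> i * H" "(Tmap p ^^ m) (\<phi> y) = \<phi> ((Tmap q ^^ i) y)" by blast
  let ?y = "(Tmap q ^^ i) y"
  let ?l = "length (w (letter q ?y))"
  have "?l \<le> H" by (rule H) (auto simp: letter_def)
  moreover have "(Tmap p ^^ (?l + m)) (\<phi> y) = \<phi> ((Tmap q ^^ Suc i) y)"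
    using codedD(3)[OF c funpow_T_in_unit[OF q y]] m(2) by (simp add: funpow_add)
  ultimately show ?case
    using m(1) by (intro exI[of _ "?l + m"]) auto
qed auto

text \<open>The bound is uniform in the starting point, so that the entry time disappears after
  division by the number of steps. One more level costs at most \<open>digit\<close> induced steps,
  each lasting at most the largest height.\<close>

lemma reach_Phi:
  assumes p: "p \<in> Omega_inf"
  shows "\<exists>B. \<forall>x\<in>{0..1}. \<exists>m\<le>B. \<exists>y\<in>{0..1}. (Tmap p ^^ m) x = Phi p n y"
proof (induction n)
  case 0
  show ?case by (rule exI[of _ 0]) auto
next
  case (Suc n)
  then obtain B where B: "\<And>x. x \<in> {0..1} \<Longrightarrow> \<exists>m\<le>B. \<exists>y\<in>{0..1}. (Tmap p ^^ m) x = Phi p n y"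
    by blast
  let ?q = "(G ^^ n) p"
  let ?h = "height (digits p) n"
  define H where "H = ?h 1 + ?h 2 + ?h 3"
  note q = Omega_infD(1)[OF p, of n]
  have "\<exists>m\<le>B + digit ?q * H. \<exists>y\<in>{0..1}. (Tmap p ^^ m) x = Phi p (Suc n) y"
    if x: "x \<in> {0..1}" for x
  proof -
    obtain m y where m: "m \<le> B" and y: "y \<in> {0..1}" "(Tmap p ^^ m) x = Phi p n y"
      using B[OF x] by blast
    obtain i z where i: "i \<le> digit ?q" and z: "z \<in> {0..1}"
      "(Tmap ?q ^^ i) y = 1 - fst ?q + fst ?q * z"
      using reach_induced[OF q y(1)] by blast
    have "length (word (digits p) n s) \<le> H" if "s \<in> {1, 2, 3}" for s
      using that by (auto simp: H_def height_def)
    then obtain l where l: "l \<le> i * H" "(Tmap p ^^ l) (Phi p n y) = Phi p n ((Tmap ?q ^^ i) y)"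
      using coded_funpow[OF coded_Phi[OF p, of n] q y(1), of H i] by blast
    have "(Tmap p ^^ (l + m)) x = Phi p (Suc n) z"
      using l(2) y(2) z(2) by (simp add: funpow_add par_def)
    moreover have "i * H \<le> digit ?q * H" using i by (rule mult_le_mono1)
    then have "l + m \<le> B + digit ?q * H" using m l(1) by linarith
    ultimately show ?thesis
      using z(1) by blast
  qed
  then show ?case by blast
qed

section \<open>Counting visits along orbits\<close>

definition visits :: "('a \<Rightarrow> 'a) \<Rightarrow> 'a set \<Rightarrow> 'a \<Rightarrow> nat \<Rightarrow> real" where
  "visits f A x n = (\<Sum>i<n. indicator A ((f ^^ i) x))"

lemma visits_add: "visits f A x (m + n) = visits f A x m + visits f A ((f ^^ m) x) n"
proof (induction n)
  case (Suc n)
  have "(f ^^ (m + n)) x = (f ^^ n) ((f ^^ m) x)"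
    by (metis add.commute comp_apply funpow_add)
  with Suc show ?case by (simp add: visits_def)
qed (simp add: visits_def)

lemma visits_nonneg: "0 \<le> visits f A x n"
  by (auto simp: visits_def intro: sum_nonneg)

lemma visits_ge_run:
  assumes "\<And>\<tau>. \<tau> < m \<Longrightarrow> (f ^^ \<tau>) ((f ^^ l) x) \<in> A" "l + m \<le> n"
  shows "real m \<le> visits f A x n"
proof -
  have "visits f A ((f ^^ l) x) m = real m"
    using assms(1) by (simp add: visits_def)
  moreover obtain e where e: "n = l + (m + e)"
    using assms(2) by (metis add.assoc le_Suc_ex)
  ultimately show ?thesis
    using visits_nonneg[of f A x l] visits_nonneg[of f A "(f ^^ m) ((f ^^ l) x)" e]
    by (simp add: visits_add)
qed

text \<open>Cut the orbit at returns to \<open>X\<close>: each complete piece spends at least 1/8 of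
  its time in \<open>A\<close>. Entering \<open>X\<close> costs at most B and the last, incomplete
  piece at most L, so the error does not grow with n.\<close>

lemma visits_ge:
  assumes X: "\<And>x. x \<in> X \<Longrightarrow> \<exists>N>0. N \<le> L \<and> (f ^^ N) x \<in> X \<and> real N \<le> 8 * visits f A x N"
    and B: "\<exists>m\<le>B. (f ^^ m) x \<in> X"
  shows "real n \<le> 8 * visits f A x n + real (B + L)"
proof -
  have 1: "real n \<le> 8 * visits f A x n + real L" if "x \<in> X" for x n
    using that
  proof (induction n arbitrary: x rule: less_induct)
    case (less n)
    obtain N where N: "N > 0" "N \<le> L" "(f ^^ N) x \<in> X" "real N \<le> 8 * visits f A x N"
      using X[OF less.prems] by blast
    show ?case
    proof (cases "n < N")
      case True
      then show ?thesis using N(2) visits_nonneg[of f A x n] by simp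
    next
      case False
      then have "visits f A x n = visits f A x N + visits f A ((f ^^ N) x) (n - N)"
        using visits_add[of f A x N "n - N"] False by simp
      moreover have "real (n - N) \<le> 8 * visits f A ((f ^^ N) x) (n - N) + real L"
        by (rule less.IH) (use N False in auto)
      moreover have "real n = real N + real (n - N)" using False by simp
      ultimately show ?thesis using N(4) by linarith
    qed
  qed
  obtain m where m: "m \<le> B" "(f ^^ m) x \<in> X" using B by blast
  show ?thesis
  proof (cases "n < m")
    case True
    then show ?thesis using m(1) visits_nonneg[of f A x n] by simp
  next
    case False
    then have "visits f A x n = visits f A x m + visits f A ((f ^^ m) x) (n - m)"
      using visits_add[of f A x m "n - m"] False by simp
    moreover have "real (n - m) \<le> 8 * visits f A ((f ^^ m) x) (n - m) + real L"
      by (rule 1[OF m(2)])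
    moreover have "real n = real m + real (n - m)" "real m \<le> real B" using False m(1) by simp_all
    ultimately show ?thesis using visits_nonneg[of f A x m] by linarith
  qed
qed

section \<open>Orbits with two competing almost periods\<close>

text \<open>The left-hand side of the last two inequalities bounds the length of all blocks of level
  $n + 3$; the right-hand sides are eight times the number of times at which such a block
  surely almost returns after $a h_1$, respectively $b h_2$, steps.\<close>
definition good :: "nat \<Rightarrow> nat \<Rightarrow> nat \<Rightarrow> nat \<Rightarrow> (nat \<Rightarrow> nat) \<Rightarrow> bool" where
  "good N n a b d \<longleftrightarrow> (let h = height d n; K = d n; K' = d (Suc n) in
     a * h 1 = b * h 2 + 1 \<and> N * a \<le> K \<and> N * b \<le> K' \<and> d (Suc (Suc n)) = 1 \<and>
     2 * h 3 + 2 * (K * h 1) + K' * h 2 \<le> 8 * ((K - 1 - a) * h 1) \<and>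
     2 * h 3 + 2 * (K * h 1) + K' * h 2 \<le> 8 * ((K' - 1 - b) * h 2))"

lemma displacement_le:
  assumes p: "p \<in> Omega_inf" and N: "N * a \<le> digits p n" "N > 0"
  shows "a * fst ((G ^^ n) p) \<le> 1 / N"
proof -
  note q = Omega_infD(1)[OF p, of n]
  have a: "0 < fst ((G ^^ n) p)" using q by (auto simp: interior_U)
  have "real (N * a) * fst ((G ^^ n) p) \<le> real (digits p n) * fst ((G ^^ n) p)"
    using N a by (intro mult_right_mono) (simp_all only: of_nat_le_iff less_imp_le)
  also have "\<dots> \<le> 1"
    using digit_bounds(2)[OF q] by (simp add: digits_def)
  finally show ?thesis
    using N(2) by (simp add: field_simps)
qed

text \<open>With upper digit 1 the words are 2, 3 1 and 3, whose images all begin with 3 1^(k-1). A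
  larger upper digit would append more letters 2, which contain no copy of the second tower of the
  level below and would dilute its run.\<close>

lemma return_word_twice:
  assumes "k > 0"
  shows "\<exists>v\<in>{[], [1], [2]}. concat (map (return_word k) (return_word 1 s)) = 3 # replicate (k - 1) 1 @ v"
proof -
  have r: "replicate k (1::nat) = replicate (k - 1) 1 @ [1]"
    using assms by (metis Suc_pred' replicate_Suc replicate_append_same)
  consider "s = 1" | "s = 2" | "s \<noteq> 1" "s \<noteq> 2" by blast
  then show ?thesis
  proof cases
    case 1
    then have "concat (map (return_word k) (return_word 1 s)) = 3 # replicate k 1" by (simp add: return_word_def)
    then show ?thesis unfolding r by blast
  next
    case 2
    then have "concat (map (return_word k) (return_word 1 s)) = 3 # replicate (k - 1) 1 @ [2]" by (simp add: return_word_def)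
    then show ?thesis by blast
  next
    case 3
    then have "concat (map (return_word k) (return_word 1 s)) = 3 # replicate (k - 1) 1 @ []" by (simp add: return_word_def)
    then show ?thesis by blast
  qed
qed

text \<open>Read at level n + 1, the block begins with 3 1^(K'-1). Its opening letter 3 unfolds at
  level n into 3 1^(K-1), the run of the first tower. A letter 1 of level n + 1 is the second tower
  of level n, so the remaining 1s form the second run.\<close>

lemma good_block:
  assumes p: "p \<in> Omega_inf" and g: "good N n a b (digits p)" and N: "N > 0"
    and y: "y \<in> {0..1}"
  defines "x \<equiv> Phi p (Suc (Suc (Suc n))) y" and "f \<equiv> Tmap p" and "h \<equiv> height (digits p) n"
  shows "\<exists>M>0. M \<le> 2 * h 3 + 2 * (digits p n * h 1) + digits p (Suc n) * h 2 \<and>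
     (f ^^ M) x \<in> Phi p (Suc (Suc (Suc n))) ` {0..1} \<and>
     real M \<le> 8 * visits f {z. \<bar>(f ^^ (a * h 1)) z - z\<bar> \<le> 1 / N} x M \<and>
     real M \<le> 8 * visits f {z. \<bar>(f ^^ (b * h 2)) z - z\<bar> \<le> 1 / N} x M"
proof -
  define K K' where "K = digits p n" and "K' = digits p (Suc n)"
  define L where "L = 2 * h 3 + 2 * (K * h 1) + K' * h 2"
  have gd: "N * a \<le> K" "N * b \<le> K'" "digits p (Suc (Suc n)) = 1"
    "L \<le> 8 * ((K - 1 - a) * h 1)" "L \<le> 8 * ((K' - 1 - b) * h 2)"
    using g by (auto simp: good_def Let_def K_def K'_def h_def L_def)
  define w where "w = word (digits p) (Suc n)"
  define q0 q1 q2 q3 where "q0 = (G ^^ n) p" and "q1 = (G ^^ Suc n) p"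
    and "q2 = (G ^^ Suc (Suc n)) p" and "q3 = (G ^^ Suc (Suc (Suc n))) p"
  have q: "q0 \<in> interior U" "q1 \<in> interior U" "q2 \<in> interior U" "q3 \<in> interior U"
    unfolding q0_def q1_def q2_def q3_def by (rule Omega_infD(1)[OF p])+
  define \<psi>0 \<psi>1 \<psi>2 where "\<psi>0 = (\<lambda>y. 1 - par p n + par p n * y)"
    and "\<psi>1 = (\<lambda>y. 1 - par p (Suc n) + par p (Suc n) * y)"
    and "\<psi>2 = (\<lambda>y. 1 - par p (Suc (Suc n)) + par p (Suc (Suc n)) * y)"
  have c0: "coded q0 \<psi>0 q1 (return_word K)" and c1: "coded q1 \<psi>1 q2 (return_word K')"
    and c2: "coded q2 \<psi>2 q3 (return_word 1)"
    using coded_step[OF p, of n] coded_step[OF p, of "Suc n"] coded_step[OF p, of "Suc (Suc n)"]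
    unfolding q0_def q1_def q2_def q3_def \<psi>0_def \<psi>1_def \<psi>2_def K_def K'_def gd(3) by auto
  note cn = coded_Phi[OF p, of n, folded q0_def]
  note cn1 = coded_Phi[OF p, of "Suc n", folded q1_def w_def]
  define y1 where "y1 = \<psi>1 (\<psi>2 y)"
  define u where "u = concat (map (return_word K') (return_word 1 (letter q3 y)))"
  note c12 = codedD[OF coded_comp[OF c1 q(3) c2] y, folded u_def, unfolded comp_apply]
  have y1: "y1 \<in> {0..1}" and fu: "follows q1 y1 u"
    and land: "(Tmap q1 ^^ length u) y1 = \<psi>1 (\<psi>2 (Tmap q3 y))"
    using c12 by (simp_all add: y1_def)
  have x1: "x = Phi p (Suc n) y1" "x = Phi p n (\<psi>0 y1)"
    by (simp_all add: x_def y1_def \<psi>0_def \<psi>1_def \<psi>2_def)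
  have Lpos: "L > 0"
    using height_pos[of "digits p" n 3] by (simp add: L_def h_def)
  have K'0: "K' > 0" using gd(5) Lpos by (cases K') auto
  obtain v where v: "u = 3 # replicate (K' - 1) 1 @ v" "v \<in> {[], [1], [2]}"
    using return_word_twice[of K' "letter q3 y"] K'0 unfolding u_def by blast
  define M where "M = length (concat (map w u))"
  have M: "(f ^^ M) x = Phi p (Suc n) (\<psi>1 (\<psi>2 (Tmap q3 y)))"
    using coded_concat[OF cn1 q(2) y1 fu] by (simp only: M_def f_def x1 land)
  also have "\<dots> = Phi p (Suc (Suc (Suc n))) (Tmap q3 y)"
    by (simp add: \<psi>1_def \<psi>2_def)
  finally have ret: "(f ^^ M) x \<in> Phi p (Suc (Suc (Suc n))) ` {0..1}"
    using T_in_unit[OF q(4) y] by blast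
  have hw: "length (w 3) = h 3 + (K - 1) * h 1" "length (w 1) = h 2" "length (w 2) = h 3 + K * h 1"
    using height_Suc[of "digits p" n] by (simp_all add: height_def w_def h_def K_def)
  have Meq: "M = length (w 3) + (K' - 1) * h 2 + length (concat (map w v))"
    unfolding M_def v(1) by (simp add: length_concat comp_def sum_list_replicate hw del: One_nat_def)
  have "length (concat (map w v)) \<le> h 3 + K * h 1 + h 2"
    using v(2) by (auto simp: hw simp del: One_nat_def)
  moreover have "(K - 1) * h 1 \<le> K * h 1" by simp
  moreover have "(K' - 1) * h 2 + h 2 = K' * h 2" using K'0 by (cases K') auto
  ultimately have M_le: "M \<le> L" unfolding Meq hw L_def by linarith
  have M0: "M > 0"
    unfolding Meq hw using height_pos[of "digits p" n 3] by (simp add: h_def)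
  have l3: "letter q1 y1 = 3" and run1: "follows q1 (Tmap q1 y1) (replicate (K' - 1) 1)"
    using fu unfolding v(1) by (auto simp: follows_append)
  have "follows q0 (\<psi>0 y1) (3 # replicate (K - 1) 1)"
    using codedD(2)[OF c0 y1] by (simp add: l3 return_word_def)
  then have l0: "letter q0 (\<psi>0 y1) = 3" and run0: "follows q0 (Tmap q0 (\<psi>0 y1)) (replicate (K - 1) 1)"
    by auto
  have \<psi>y: "\<psi>0 y1 \<in> {0..1}" by (rule codedD(1)[OF c0 y1])
  \<comment> \<open>The first run starts after one climb of the third tower of level n.\<close>
  have s0: "(f ^^ h 3) x = Phi p n (Tmap q0 (\<psi>0 y1))"
    using codedD(3)[OF cn \<psi>y] by (simp add: l0 f_def x1(2) h_def height_def)
  \<comment> \<open>The second run starts only after the third tower of level n + 1, which contains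
    the first run.\<close>
  have s1: "(f ^^ length (w 3)) x = Phi p (Suc n) (Tmap q1 y1)"
    using codedD(3)[OF cn1 y1] by (simp only: l3 f_def x1(1))
  have "\<bar>(f ^^ (a * h 1)) ((f ^^ \<tau>) ((f ^^ h 3) x)) - (f ^^ \<tau>) ((f ^^ h 3) x)\<bar> \<le> 1 / N"
    if "\<tau> < (K - 1 - a) * h 1" for \<tau>
  proof -
    have "\<bar>(f ^^ (a * h 1)) ((f ^^ \<tau>) ((f ^^ h 3) x)) - (f ^^ \<tau>) ((f ^^ h 3) x)\<bar> \<le> a * fst q0"
      unfolding s0 unfolding f_def
      by (rule coded_run[OF cn q(1) T_in_unit[OF q(1) \<psi>y] Phi_diff[OF p] run0 _ that])
        (simp add: h_def height_def)
    also have "\<dots> \<le> 1 / N"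
      unfolding q0_def using gd(1) N by (intro displacement_le[OF p]) (auto simp: K_def)
    finally show ?thesis .
  qed
  moreover have "h 3 + (K - 1 - a) * h 1 \<le> M"
  proof -
    have "(K - 1 - a) * h 1 \<le> (K - 1) * h 1" by (rule mult_le_mono1) simp
    then show ?thesis unfolding Meq hw by linarith
  qed
  ultimately have v0: "real ((K - 1 - a) * h 1) \<le>
      visits f {z. \<bar>(f ^^ (a * h 1)) z - z\<bar> \<le> 1 / N} x M"
    by (intro visits_ge_run) auto
  have "\<bar>(f ^^ (b * h 2)) ((f ^^ \<tau>) ((f ^^ length (w 3)) x)) - (f ^^ \<tau>) ((f ^^ length (w 3)) x)\<bar> \<le> 1 / N"
    if "\<tau> < (K' - 1 - b) * h 2" for \<tau>
  proof -
    have "\<bar>(f ^^ (b * h 2)) ((f ^^ \<tau>) ((f ^^ length (w 3)) x)) - (f ^^ \<tau>) ((f ^^ length (w 3)) x)\<bar>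
        \<le> b * fst q1"
      unfolding s1 unfolding f_def
      by (rule coded_run[OF cn1 q(2) T_in_unit[OF q(2) y1] Phi_diff[OF p] run1 _ that])
        (simp only: hw)
    also have "\<dots> \<le> 1 / N"
      unfolding q1_def using gd(2) N by (intro displacement_le[OF p]) (auto simp: K'_def)
    finally show ?thesis .
  qed
  moreover have "length (w 3) + (K' - 1 - b) * h 2 \<le> M"
  proof -
    have "(K' - 1 - b) * h 2 \<le> (K' - 1) * h 2" by (rule mult_le_mono1) simp
    then show ?thesis unfolding Meq by linarith
  qed
  ultimately have v1: "real ((K' - 1 - b) * h 2) \<le>
      visits f {z. \<bar>(f ^^ (b * h 2)) z - z\<bar> \<le> 1 / N} x M"
    by (intro visits_ge_run) auto
  have "M \<le> 8 * ((K - 1 - a) * h 1)" "M \<le> 8 * ((K' - 1 - b) * h 2)"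
    using M_le gd(4,5) by linarith+
  then have "real M \<le> 8 * real ((K - 1 - a) * h 1)" "real M \<le> 8 * real ((K' - 1 - b) * h 2)"
    by (metis of_nat_le_iff of_nat_mult of_nat_numeral)+
  then have "real M \<le> 8 * visits f {z. \<bar>(f ^^ (a * h 1)) z - z\<bar> \<le> 1 / N} x M"
    "real M \<le> 8 * visits f {z. \<bar>(f ^^ (b * h 2)) z - z\<bar> \<le> 1 / N} x M"
    using v0 v1 by linarith+
  then show ?thesis
    using M_le M0 ret unfolding L_def K_def K'_def by blast
qed

lemma good_recurrence:
  assumes p: "p \<in> Omega_inf" and g: "good N n a b (digits p)" and N: "N > 0"
  shows "\<exists>t B. \<forall>s\<in>{t, Suc t}. \<forall>x\<in>{0..1}. \<forall>m.
    real m \<le> 8 * visits (Tmap p) {z. \<bar>(Tmap p ^^ s) z - z\<bar> \<le> 1 / N} x m + real B"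
proof -
  define h where "h = height (digits p) n"
  define L where "L = 2 * h 3 + 2 * (digits p n * h 1) + digits p (Suc n) * h 2"
  let ?X = "Phi p (Suc (Suc (Suc n))) ` {0..1}"
  let ?A = "\<lambda>s. {z. \<bar>(Tmap p ^^ s) z - z\<bar> \<le> 1 / N}"
  obtain B where B: "\<forall>x\<in>{0..1}. \<exists>m\<le>B. \<exists>y\<in>{0..1}. (Tmap p ^^ m) x = Phi p (Suc (Suc (Suc n))) y"
    using reach_Phi[OF p, of "Suc (Suc (Suc n))"] ..
  have eq: "a * h 1 = Suc (b * h 2)"
    using g unfolding good_def Let_def h_def by linarith
  have *: "real m \<le> 8 * visits (Tmap p) (?A s) x m + real (B + L)"
    if s: "s \<in> {b * h 2, Suc (b * h 2)}" and x: "x \<in> {0..1}" for s x m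
  proof (rule visits_ge[of ?X])
    from bspec[OF B x] obtain m y where "m \<le> B" "y \<in> {0..1}" "(Tmap p ^^ m) x = Phi p (Suc (Suc (Suc n))) y"
      by (elim exE bexE conjE)
    then show "\<exists>m\<le>B. (Tmap p ^^ m) x \<in> ?X" by (intro exI[of _ m]) (simp only: imageI simp_thms)
    show "\<exists>M>0. M \<le> L \<and> (Tmap p ^^ M) z \<in> ?X \<and> real M \<le> 8 * visits (Tmap p) (?A s) z M"
      if z: "z \<in> ?X" for z
    proof -
      from z obtain y where y: "z = Phi p (Suc (Suc (Suc n))) y" "y \<in> {0..1}"
        by (rule imageE)
      obtain M where M: "M > 0 \<and> M \<le> L \<and> (Tmap p ^^ M) z \<in> ?X \<and>
        real M \<le> 8 * visits (Tmap p) (?A (a * h 1)) z M \<and>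
        real M \<le> 8 * visits (Tmap p) (?A (b * h 2)) z M"
        using good_block[OF p g N y(2), folded h_def, folded L_def y(1)] ..
      from s have "s = b * h 2 \<or> s = a * h 1" unfolding eq by simp
      then have "real M \<le> 8 * visits (Tmap p) (?A s) z M"
        using M by (elim disjE) simp_all
      then show ?thesis using M by (intro exI[of _ M]) simp
    qed
  qed
  show ?thesis
    by (intro exI[of _ "b * h 2"] exI[of _ "B + L"] ballI allI) (rule *)
qed

section \<open>Genericity of good parameters\<close>

lemma good_cong:
  assumes "\<And>i. i \<le> Suc (Suc n) \<Longrightarrow> d i = d' i"
  shows "good N n a b d \<longleftrightarrow> good N n a b d'"
proof -
  have "height d n = height d' n" using assms by (intro ext height_cong) auto
  then show ?thesis using assms by (simp add: good_def)
qed

text \<open>The digit k at place m makes the first two heights of level m + 1 coprime, and Bezout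
  supplies a and b. The next digits are M h_2 and M h_1, so that both runs have length about M h_1
  h_2.\<close>

lemma exists_good_extension:
  assumes d: "\<And>i. i < m \<Longrightarrow> d i \<ge> 1"
  shows "\<exists>d' n a b. (\<forall>i<m. d' i = d i) \<and> (\<forall>i. d' i \<ge> 1) \<and> good N n a b d'"
proof -
  obtain k where k: "k \<ge> 1" "coprime (height d m 2) (height d m 3 + k * height d m 1)"
    using exists_coprime_shift[OF gcd_heights height_pos] d by blast
  define e where "e = d(m := k)"
  define h where "h = height e (Suc m)"
  have "height e m = height d m" by (intro ext height_cong) (auto simp: e_def)
  then have cop: "coprime (h 1) (h 2)"
    using k(2) by (simp add: h_def e_def)
  have h0: "h s > 0" for s unfolding h_def by (rule height_pos)
  obtain a b where "h 1 * a = h 2 * b + gcd (h 1) (h 2)"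
    using bezout_nat[of "h 1" "h 2"] h0[of 1] by auto
  then have ab: "a * h 1 = b * h 2 + 1" using cop by (simp add: mult.commute)
  \<comment> \<open>The term N (a + b) serves the displacement bounds. The others ensure that losing
    a + 1 or b + 1 climbs, and absorbing h 3, costs at most half of a run.\<close>
  define M where "M = N * (a + b) + 2 * (a + b + 1) + 2 * h 3"
  define d' where "d' i = (if i < m then d i else if i = m then k else if i = Suc m then M * h 2
    else if i = Suc (Suc m) then M * h 1 else 1)" for i
  have hd: "height d' (Suc m) = h"
    unfolding h_def by (intro ext height_cong) (auto simp: d'_def e_def)
  have MM: "M \<le> M * h 1" "M \<le> M * h 2" using h0[of 1] h0[of 2] by simp_all
  have "N * a \<le> M" "N * b \<le> M" by (simp_all add: M_def algebra_simps)
  then have N: "N * a \<le> M * h 2" "N * b \<le> M * h 1" using MM by linarith+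
  \<comment> \<open>With X = M h1 h2 the left side is 3 X + 2 h 3, while the shortened run has
    length at least X/2 + h 3, so the factor 8 suffices. Exchanging h1 and h2 covers both
    runs.\<close>
  have c: "2 * h 3 + 2 * (M * h2 * h1) + M * h1 * h2 \<le> 8 * ((M * h2 - 1 - c) * h1)"
    if h2: "h2 > 0" and h1: "h1 > 0" and c: "c \<le> a + b" for h1 h2 c :: nat
  proof -
    have "2 * (1 + c) + 2 * h 3 \<le> M" using c by (simp add: M_def)
    also have "M \<le> M * h2" using h2 by simp
    finally have 1: "2 * (1 + c) + 2 * h 3 \<le> M * h2" .
    have "X + z \<le> 2 * (X - 1 - c)" if "2 * (1 + c) + z \<le> X" for X z :: nat
      using that by arith
    from this[OF 1] have "M * h2 + 2 * h 3 \<le> 2 * (M * h2 - 1 - c)" .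
    then have "(M * h2 + 2 * h 3) * h1 \<le> 2 * (M * h2 - 1 - c) * h1" by (rule mult_le_mono1)
    then have "M * h2 * h1 + 2 * h 3 * h1 \<le> 2 * ((M * h2 - 1 - c) * h1)"
      by (simp only: add_mult_distrib mult.assoc)
    moreover have "2 * h 3 \<le> 2 * h 3 * h1" using h1 by simp
    moreover have "M * h1 * h2 = M * h2 * h1" by simp
    ultimately show ?thesis by linarith
  qed
  have d'_eq: "d' (Suc m) = M * h 2" "d' (Suc (Suc m)) = M * h 1" "d' (Suc (Suc (Suc m))) = 1"
    by (simp_all add: d'_def)
  have "M * h 2 * h 1 = M * h 1 * h 2" by simp
  then have "2 * h 3 + 2 * (M * h 2 * h 1) + M * h 1 * h 2 \<le> 8 * ((M * h 1 - 1 - b) * h 2)"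
    using c[of "h 1" "h 2" b, OF h0 h0] by linarith
  then have "good N (Suc m) a b d'"
    unfolding good_def Let_def hd d'_eq using N ab c[of "h 2" "h 1" a, OF h0 h0] by simp
  moreover have "M > 0" by (simp add: M_def)
  then have "d' i \<ge> 1" for i
    using d[of i] k(1) h0[of 1] h0[of 2] by (simp add: d'_def Suc_le_eq)
  moreover have "\<forall>i<m. d' i = d i" by (simp add: d'_def)
  ultimately show ?thesis by blast
qed

lemma dense_good:
  assumes p: "p \<in> Omega_inf" and e: "e > 0"
  shows "\<exists>q\<in>Omega_inf. dist q p < e \<and> (\<exists>n a b. good N n a b (digits q))"
proof -
  obtain m :: nat where m: "6 / e < real m" using reals_Archimedean2 by blast
  then have "6 < e * (2 + real m)" using e by (simp add: field_simps)
  then have m': "6 / (2 + real m) < e" by (simp add: field_simps)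
  have "digits p i \<ge> 1" for i
    unfolding digits_def by (rule digit_bounds(1)[OF Omega_infD(1)[OF p]])
  then obtain d n a b where d: "\<And>i. i < 2 * m \<Longrightarrow> d i = digits p i" "\<And>i. d i \<ge> 1" "good N n a b d"
    using exists_good_extension[of "2 * m" "digits p" N] by blast
  obtain r where r: "r \<in> Omega_inf" using Omega_inf_nonempty by blast
  \<comment> \<open>\<open>good\<close> at n reads the digits up to n + 2, and closeness to p needs
    the first 2 m; the length 2 m + n + 3 covers both.\<close>
  obtain q where q: "q \<in> Omega_inf" and
    dq: "\<And>j. j < 2 * m + n + 3 \<Longrightarrow> digit ((G ^^ j) q) = d j"
    using branches[OF r, of "map d [0..<2 * m + n + 3]"] d(2) by auto
  have "good N n a b (digits q)"
    using d(3) dq by (subst good_cong[of n "digits q" d]) (auto simp: digits_def)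
  moreover have "dist q p \<le> 6 / (2 + real m)"
    using dq d(1) by (intro dist_le_of_digits[OF q p]) (auto simp: digits_def)
  then have "dist q p < e" using m' by linarith
  ultimately show ?thesis using q by blast
qed

text \<open>For fixed n the condition reads finitely many digits, and these are locally
  constant.\<close>

lemma openin_good:
  "openin (top_of_set Omega_inf) {p \<in> Omega_inf. \<exists>n a b. good N n a b (digits p)}"
proof (subst openin_subopen, intro ballI)
  let ?D = "{p \<in> Omega_inf. \<exists>n a b. good N n a b (digits p)}"
  fix p assume "p \<in> ?D"
  then obtain n a b where p: "p \<in> Omega_inf" and g: "good N n a b (digits p)" by blast
  obtain V where V: "open V" "p \<in> V"
    "\<And>q. q \<in> V \<Longrightarrow> \<forall>i\<le>Suc (Suc n). digit ((G ^^ i) q) = digit ((G ^^ i) p)"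
    using eventually_digit_eq[OF p, of "Suc (Suc n)"] unfolding eventually_nhds by blast
  have "good N n a b (digits q)" if "q \<in> V" for q
    using g V(3)[OF that] by (subst good_cong[of n "digits q" "digits p"]) (auto simp: digits_def)
  then have "Omega_inf \<inter> V \<subseteq> ?D" by blast
  moreover have "openin (top_of_set Omega_inf) (Omega_inf \<inter> V)"
    using V(1) by (rule openin_open_Int)
  ultimately show "\<exists>S. openin (top_of_set Omega_inf) S \<and> p \<in> S \<and> S \<subseteq> ?D"
    using p V(2) by blast
qed

lemma dense_gdelta_good:
  defines "D \<equiv> {p \<in> Omega_inf. \<forall>N. \<exists>n a b. good N n a b (digits p)}"
  shows "gdelta_in (top_of_set Omega_inf) D" "Omega_inf \<subseteq> closure D"
proof -
  define E where "E N = {p \<in> Omega_inf. \<exists>n a b. good N n a b (digits p)}" for N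
  have D: "D = \<Inter>(range E)" by (auto simp: D_def E_def)
  have op: "openin (top_of_set Omega_inf) (E N)" for N
    unfolding E_def by (rule openin_good)
  then show "gdelta_in (top_of_set Omega_inf) D"
    unfolding D by (intro gdelta_in_Inter) (auto intro: open_imp_gdelta_in)
  have "top_of_set Omega_inf closure_of E N = Omega_inf" for N
  proof -
    have "Omega_inf \<subseteq> closure (E N)"
    proof
      fix p assume "p \<in> Omega_inf"
      then show "p \<in> closure (E N)"
        unfolding closure_approachable E_def using dense_good[of p _ N] by blast
    qed
    moreover have "E N \<subseteq> Omega_inf" by (auto simp: E_def)
    ultimately show ?thesis
      by (auto simp: closure_of_subtopology Int_absorb1 Int_absorb2)
  qed
  moreover have "completely_metrizable_space (top_of_set Omega_inf)"
    by (intro completely_metrizable_space_gdelta_in completely_metrizable_space_euclidean gdelta_Omega_inf)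
  ultimately have "top_of_set Omega_inf closure_of D = Omega_inf"
    using Baire_category[of "top_of_set Omega_inf" "range E"] op unfolding D by auto
  moreover have "D \<subseteq> Omega_inf" by (auto simp: D_def)
  ultimately show "Omega_inf \<subseteq> closure D"
    by (auto simp: closure_of_subtopology Int_absorb1 Int_absorb2)
qed

section \<open>Eigenfunctions\<close>

lemma borel_measurable_T [measurable]: "T \<alpha> \<beta> \<in> borel_measurable borel"
  unfolding T_def by measurable

lemma
  fixes f :: "'a::topological_space \<Rightarrow> 'a"
  assumes sets: "sets M = sets borel" and f: "f \<in> borel_measurable borel" and inv: "distr M borel f = M"
  shows measurable_invariant: "f \<in> measurable M borel"
    and AE_invariant: "(AE x in M. Q x) \<Longrightarrow> (AE x in M. Q (f x))"
    and integral_invariant: "(h :: 'a \<Rightarrow> real) \<in> borel_measurable borel \<Longrightarrow> (\<integral>x. h (f x) \<partial>M) = (\<integral>x. h x \<partial>M)"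
    and integrable_invariant: "(h' :: 'a \<Rightarrow> 'b::{banach, second_countable_topology}) \<in> borel_measurable borel
      \<Longrightarrow> integrable M h' \<Longrightarrow> integrable M (\<lambda>x. h' (f x))"
proof -
  show m: "f \<in> measurable M borel"
    using f sets measurable_cong_sets by blast
  show "(AE x in M. Q x) \<Longrightarrow> (AE x in M. Q (f x))"
    using AE_distrD[OF m, of Q] unfolding inv .
  show "h \<in> borel_measurable borel \<Longrightarrow> (\<integral>x. h (f x) \<partial>M) = (\<integral>x. h x \<partial>M)"
    using integral_distr[OF m, of h] inv by simp
  show "h' \<in> borel_measurable borel \<Longrightarrow> integrable M h' \<Longrightarrow> integrable M (\<lambda>x. h' (f x))"
    using integrable_distr_eq[OF m, of h'] inv by simp
qed

lemma funpow_invariant: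
  fixes f :: "'a::topological_space \<Rightarrow> 'a"
  assumes sets: "sets M = sets borel" and f: "f \<in> borel_measurable borel" and inv: "distr M borel f = M"
  shows "f ^^ i \<in> borel_measurable borel" "distr M borel (f ^^ i) = M"
proof -
  show fi: "f ^^ i \<in> borel_measurable borel" for i
    by (induction i) (use f in \<open>auto simp: id_def intro: measurable_compose\<close>)
  show "distr M borel (f ^^ i) = M"
  proof (induction i)
    case 0
    have "distr M borel (\<lambda>x. x) = M" using sets by (intro distr_id2) simp
    then show ?case by (simp add: id_def)
  next
    case (Suc i)
    have "distr M borel (f \<circ> (f ^^ i)) = distr (distr M borel (f ^^ i)) borel f"
      using f measurable_invariant[OF sets fi Suc] by (intro distr_distr[symmetric])
    then show ?case using Suc inv by (simp add: comp_def)
  qed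
qed

text \<open>Multiply the visit bound by g, which is constant along almost every orbit, and
  integrate: invariance of the measure gives m I \<le> 8 m J + B I for every m, and the last term is
  negligible for large m.\<close>

lemma integral_le_visits:
  fixes f :: "real \<Rightarrow> real" and g :: "real \<Rightarrow> real"
  assumes sets: "sets M = sets borel" and f: "f \<in> borel_measurable borel" and inv: "distr M borel f = M"
    and g: "integrable M g" "\<And>x. 0 \<le> g x" and g_inv: "AE x in M. g (f x) = g x"
    and A: "A \<in> sets borel"
    and vis: "AE x in M. \<forall>m. real m \<le> 8 * visits f A x m + real B"
  shows "(\<integral>x. g x \<partial>M) \<le> 8 * (\<integral>x. indicator A x * g x \<partial>M)"
proof -
  note fi = funpow_invariant[OF sets f inv]
  have gb: "g \<in> borel_measurable borel"
    using borel_measurable_integrable[OF g(1)] sets measurable_cong_sets by blast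
  have gi: "AE x in M. g ((f ^^ i) x) = g x" for i
  proof (induction i)
    case (Suc i)
    show ?case
      using AE_invariant[OF sets f inv Suc] g_inv
      by eventually_elim (simp add: funpow_swap1)
  qed simp
  define I J where "I = (\<integral>x. g x \<partial>M)" and "J = (\<integral>x. indicator A x * g x \<partial>M)"
  define gA where "gA = (\<lambda>x. indicator A x * g x)"
  have gA: "integrable M gA" "gA \<in> borel_measurable borel"
    using integrable_mult_indicator[of A M g] A g(1) gb by (auto simp: gA_def sets)
  have bound: "real m * I \<le> 8 * (real m * J) + real B * I" for m
  proof -
    have "(\<integral>x. (\<Sum>i<m. gA ((f ^^ i) x)) \<partial>M) = (\<Sum>i<m. \<integral>x. gA ((f ^^ i) x) \<partial>M)"
      by (intro Bochner_Integration.integral_sum integrable_invariant[OF sets fi] gA)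
    also have "\<dots> = real m * J"
      using integral_invariant[OF sets fi gA(2)] by (simp add: J_def gA_def)
    finally have 1: "(\<integral>x. (\<Sum>i<m. gA ((f ^^ i) x)) \<partial>M) = real m * J" .
    have int: "integrable M (\<lambda>x. \<Sum>i<m. gA ((f ^^ i) x))"
      by (intro Bochner_Integration.integrable_sum integrable_invariant[OF sets fi] gA)
    have "AE x in M. \<forall>i\<in>{..<m}. g ((f ^^ i) x) = g x"
      using gi by (intro AE_finite_allI) auto
    then have "AE x in M. real m * g x \<le> 8 * (\<Sum>i<m. gA ((f ^^ i) x)) + real B * g x"
      using vis
    proof eventually_elim
      case (elim x)
      have "(\<Sum>i<m. gA ((f ^^ i) x)) = visits f A x m * g x"
        unfolding visits_def sum_distrib_right using elim(1) by (intro sum.cong) (auto simp: gA_def)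
      moreover have "real m * g x \<le> (8 * visits f A x m + real B) * g x"
        using elim(2) g(2) by (intro mult_right_mono) auto
      ultimately show ?case by (simp add: algebra_simps)
    qed
    then have "(\<integral>x. real m * g x \<partial>M) \<le> (\<integral>x. 8 * (\<Sum>i<m. gA ((f ^^ i) x)) + real B * g x \<partial>M)"
      using int g(1) by (intro integral_mono_AE) auto
    then show ?thesis
      using int g(1) 1 by (simp add: I_def)
  qed
  have "I \<le> 8 * J"
  proof (rule ccontr)
    assume "\<not> I \<le> 8 * J"
    then have "I - 8 * J > 0" by simp
    then obtain m :: nat where "real B * I < real m * (I - 8 * J)"
      using reals_Archimedean3 by blast
    then show False using bound[of m] by (simp add: algebra_simps)
  qed
  then show ?thesis by (simp add: I_def J_def)
qed

section \<open>Continuity in mean under measure-preserving maps\<close>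

lemma borel_set_squeeze:
  fixes A :: "'a::{second_countable_topology, complete_space} set"
  assumes "finite_measure M" and sets: "sets M = sets borel" and A: "A \<in> sets borel" and e: "e > 0"
  obtains K V where "compact K" "open V" "K \<subseteq> A" "A \<subseteq> V" "measure M (V - K) \<le> e"
proof -
  interpret finite_measure M by fact
  have fin: "emeasure M (space M) \<noteq> \<infinity>" by simp
  have "\<exists>K\<in>{K. K \<subseteq> A \<and> compact K}. measure M A - e / 2 < measure M K"
  proof (rule ccontr)
    assume neg: "\<not> ?thesis"
    then have "emeasure M K \<le> ennreal (measure M A - e / 2)" if "K \<subseteq> A" "compact K" for K
      using that by (auto simp: emeasure_eq_measure not_less intro!: ennreal_leI)
    then have "emeasure M A \<le> ennreal (measure M A - e / 2)"
      unfolding inner_regular[OF sets fin A] by (intro SUP_least) auto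
    moreover have "measure M {} \<le> measure M A - e / 2"
      using neg compact_empty not_less by blast
    ultimately show False
      using e by (auto simp: emeasure_eq_measure ennreal_le_iff2)
  qed
  then obtain K where K: "K \<subseteq> A" "compact K" "measure M A - e / 2 < measure M K" by blast
  have "\<exists>V\<in>{V. A \<subseteq> V \<and> open V}. measure M V < measure M A + e / 2"
  proof (rule ccontr)
    assume "\<not> ?thesis"
    then have "ennreal (measure M A + e / 2) \<le> emeasure M V" if "A \<subseteq> V" "open V" for V
      using that by (auto simp: emeasure_eq_measure not_less intro!: ennreal_leI)
    then have "ennreal (measure M A + e / 2) \<le> emeasure M A"
      unfolding outer_regular[OF sets fin A] by (intro INF_greatest) auto
    then show False
      using e by (auto simp: emeasure_eq_measure)
  qed
  then obtain V where V: "A \<subseteq> V" "open V" "measure M V < measure M A + e / 2" by blast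
  have "measure M (V - K) = measure M V - measure M K"
    using K V by (intro finite_measure_Diff) (auto simp: sets compact_imp_closed)
  then have "measure M (V - K) \<le> e" using K(3) V(3) by simp
  then show thesis using that K V by blast
qed

text \<open>A measurable substitute for uniform continuity. The choice of \<epsilon> precedes S,
  because S will be a power of \<open>T\<close> whose exponent depends on \<epsilon>. Preservation
  of M keeps S from carrying much mass into a small exceptional set.\<close>

definition almost_invariant :: "real measure \<Rightarrow> (real \<Rightarrow> complex) \<Rightarrow> bool" where
  "almost_invariant M F \<longleftrightarrow> (\<forall>\<eta>>0. \<exists>\<epsilon>>0. \<forall>S. S \<in> borel_measurable borel \<longrightarrow> distr M borel S = M \<longrightarrow>
     (\<integral>x. indicator {x. \<bar>S x - x\<bar> \<le> \<epsilon>} x * norm (F (S x) - F x) \<partial>M) \<le> \<eta>)"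

text \<open>If x and S x are closer than K and the complement of V, they can be separated by A only
  when one of them lies in V - K. Each of these two events has mass at most \<delta>, since S
  preserves M.\<close>

lemma almost_invariant_indicator:
  assumes "finite_measure M" and sets: "sets M = sets borel" and A: "A \<in> sets M"
  shows "almost_invariant M (\<lambda>x. indicator A x *\<^sub>R c)"
  unfolding almost_invariant_def
proof (intro allI impI)
  interpret finite_measure M by fact
  fix \<eta> :: real assume \<eta>: "\<eta> > 0"
  \<comment> \<open>Two events of mass \<delta> with jump \<open>norm c\<close> contribute at most
    \<eta>; the added 1 covers c = 0.\<close>
  define \<delta> where "\<delta> = \<eta> / (norm c + 1) / 2"
  have \<delta>: "\<delta> > 0" using \<eta> by (simp add: \<delta>_def add_nonneg_pos)
  obtain K V where KV: "compact K" "open V" "K \<subseteq> A" "A \<subseteq> V" "measure M (V - K) \<le> \<delta>"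
    using borel_set_squeeze[OF assms(1) sets _ \<delta>] A unfolding sets by blast
  have "closed (- V)" "K \<inter> - V = {}" using KV by (auto simp: open_closed)
  then obtain e where e: "e > 0" "\<And>x y. x \<in> K \<Longrightarrow> y \<in> - V \<Longrightarrow> e \<le> dist x y"
    using separate_compact_closed[of K "- V"] KV(1) by blast
  have B: "V - K \<in> sets borel"
    using KV(1,2) by (intro sets.Diff borel_open borel_closed compact_imp_closed)
  show "\<exists>\<epsilon>>0. \<forall>S. S \<in> borel_measurable borel \<longrightarrow> distr M borel S = M \<longrightarrow>
     (\<integral>x. indicator {x. \<bar>S x - x\<bar> \<le> \<epsilon>} x * norm (indicator A (S x) *\<^sub>R c - indicator A x *\<^sub>R c) \<partial>M) \<le> \<eta>"
  proof (intro exI[of _ "e / 2"] conjI allI impI)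
    show "e / 2 > 0" using e(1) by simp
    fix S assume S: "S \<in> borel_measurable borel" "distr M borel S = M"
    let ?f = "\<lambda>x. indicator {x. \<bar>S x - x\<bar> \<le> e / 2} x * norm (indicator A (S x) *\<^sub>R c - indicator A x *\<^sub>R c)"
    let ?b = "indicator (V - K) :: real \<Rightarrow> real"
    have int: "integrable M ?b" "?b \<in> borel_measurable borel"
      using B by (auto simp: sets emeasure_eq_measure)
    have intS: "integrable M (\<lambda>x. ?b (S x))"
      by (rule integrable_invariant[OF sets S int(2,1)])
    have le: "?f x \<le> norm c * (?b x + ?b (S x))" for x
    proof (cases "\<bar>S x - x\<bar> \<le> e / 2 \<and> (x \<in> A) \<noteq> (S x \<in> A)")
      case True
      then have d: "dist x (S x) < e" "dist (S x) x < e"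
        using e(1) unfolding dist_real_def by linarith+
      have "S x \<in> V" if "x \<in> K"
        using e(2)[OF that, of "S x"] d(1) by force
      moreover have "x \<in> V" if "S x \<in> K"
        using e(2)[OF that, of x] d(2) by force
      ultimately have "x \<in> V - K \<or> S x \<in> V - K"
        using True KV(3,4) by blast
      then have "1 \<le> ?b x + ?b (S x)" by (auto simp: indicator_def)
      then have "norm c * 1 \<le> norm c * (?b x + ?b (S x))" by (rule mult_left_mono) simp
      moreover have "?f x \<le> norm c" by (auto simp: indicator_def)
      ultimately show ?thesis by linarith
    next
      case False
      then have "?f x = 0" by (auto simp: indicator_def)
      moreover have "0 \<le> norm c * (?b x + ?b (S x))" by simp
      ultimately show ?thesis by linarith
    qed
    have "(\<integral>x. ?f x \<partial>M) \<le> (\<integral>x. norm c * (?b x + ?b (S x)) \<partial>M)"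
      using int intS by (intro integral_mono_AE' AE_I2 le) auto
    also have "\<dots> = norm c * (measure M (V - K) + measure M (V - K))"
      using int intS integral_invariant[OF sets S int(2)] by (simp add: sets_eq_imp_space_eq[OF sets])
    also have "\<dots> \<le> norm c * (\<delta> + \<delta>)"
      using KV(5) by (intro mult_left_mono add_mono) auto
    also have "\<delta> + \<delta> = \<eta> / (norm c + 1)" unfolding \<delta>_def by (rule field_sum_of_halves)
    also have "norm c * \<dots> = \<eta> * (norm c / (norm c + 1))" by simp
    also have "\<dots> \<le> \<eta> * 1" using \<eta> by (intro mult_left_mono) (auto simp: divide_le_eq_1 add_nonneg_pos)
    finally show "(\<integral>x. ?f x \<partial>M) \<le> \<eta>" by simp
  qed
qed

lemma near_set_borel:
  fixes S :: "real \<Rightarrow> real"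
  assumes "S \<in> borel_measurable borel"
  shows "{x. \<bar>S x - x\<bar> \<le> e} \<in> sets borel"
proof -
  have "{x \<in> space borel. \<bar>S x - x\<bar> \<le> e} \<in> sets borel"
    using assms by measurable
  then show ?thesis by simp
qed

text \<open>Replacing F by H costs the L1 distance once at x and once at S x, and the two costs
  agree because S preserves M. This makes almost invariance pass to L1 limits.\<close>

lemma near_integral_le:
  fixes F H :: "real \<Rightarrow> complex"
  assumes sets: "sets M = sets borel" and S: "S \<in> borel_measurable borel" "distr M borel S = M"
    and F: "integrable M F" and H: "integrable M H" and e: "e' \<le> e"
  shows "(\<integral>x. indicator {x. \<bar>S x - x\<bar> \<le> e'} x * norm (F (S x) - F x) \<partial>M) \<le>
    (\<integral>x. indicator {x. \<bar>S x - x\<bar> \<le> e} x * norm (H (S x) - H x) \<partial>M) + 2 * (\<integral>x. norm (F x - H x) \<partial>M)"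
proof -
  let ?A = "{x. \<bar>S x - x\<bar> \<le> e}"
  have A: "?A \<in> sets M"
    using near_set_borel[OF S(1)] sets by simp
  have b: "F \<in> borel_measurable borel" "H \<in> borel_measurable borel"
    using borel_measurable_integrable[OF F] borel_measurable_integrable[OF H] sets measurable_cong_sets by blast+
  note i = integrable_invariant[OF sets S]
  have FH: "integrable M (\<lambda>x. norm (F x - H x))" "(\<lambda>x. norm (F x - H x)) \<in> borel_measurable borel"
    using F H b by auto
  have HS: "integrable M (\<lambda>x. indicator ?A x * norm (H (S x) - H x))"
    using integrable_mult_indicator[OF A, of "\<lambda>x. norm (H (S x) - H x)"] i[OF b(2) H] H by simp
  have "(\<integral>x. indicator {x. \<bar>S x - x\<bar> \<le> e'} x * norm (F (S x) - F x) \<partial>M) \<le>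
    (\<integral>x. indicator ?A x * norm (H (S x) - H x) + (norm (F (S x) - H (S x)) + norm (F x - H x)) \<partial>M)"
  proof (intro integral_mono_AE' AE_I2)
    show "integrable M (\<lambda>x. indicator ?A x * norm (H (S x) - H x) + (norm (F (S x) - H (S x)) + norm (F x - H x)))"
      using HS i[OF FH(2,1)] FH by auto
    fix x
    have "norm (F (S x) - F x) \<le> norm (H (S x) - H x) + (norm (F (S x) - H (S x)) + norm (F x - H x))"
      using norm_triangle_le[of "H (S x) - H x" "(F (S x) - H (S x)) - (F x - H x)"]
        norm_triangle_ineq4[of "F (S x) - H (S x)" "F x - H x"] by simp
    then show "indicator {x. \<bar>S x - x\<bar> \<le> e'} x * norm (F (S x) - F x) \<le>
      indicator ?A x * norm (H (S x) - H x) + (norm (F (S x) - H (S x)) + norm (F x - H x))"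
      using e by (auto simp: indicator_def)
  qed (auto simp: indicator_def)
  also have "\<dots> = (\<integral>x. indicator ?A x * norm (H (S x) - H x) \<partial>M) +
      ((\<integral>x. norm (F (S x) - H (S x)) \<partial>M) + (\<integral>x. norm (F x - H x) \<partial>M))"
    using HS i[OF FH(2,1)] FH by simp
  also have "(\<integral>x. norm (F (S x) - H (S x)) \<partial>M) = (\<integral>x. norm (F x - H x) \<partial>M)"
    by (rule integral_invariant[OF sets S FH(2)])
  finally show ?thesis by simp
qed

lemma almost_invariant_integrable:
  assumes fin: "finite_measure M" and sets: "sets M = sets borel" and F: "integrable M F"
  shows "almost_invariant M F"
  using F
proof (induction rule: integrable_induct)
  case (base A c)
  then show ?case by (intro almost_invariant_indicator fin sets)
next
  case (add F H)
  show ?case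
    unfolding almost_invariant_def
  proof (intro allI impI)
    fix \<eta> :: real assume "\<eta> > 0"
    then have \<eta>2: "\<eta> / 2 > 0" by simp
    from add(3)[unfolded almost_invariant_def, THEN spec, THEN mp, OF \<eta>2]
    obtain e1 where e1: "e1 > 0 \<and> (\<forall>S. S \<in> borel_measurable borel \<longrightarrow> distr M borel S = M \<longrightarrow>
      (\<integral>x. indicator {x. \<bar>S x - x\<bar> \<le> e1} x * norm (F (S x) - F x) \<partial>M) \<le> \<eta> / 2)" ..
    from add(4)[unfolded almost_invariant_def, THEN spec, THEN mp, OF \<eta>2]
    obtain e2 where e2: "e2 > 0 \<and> (\<forall>S. S \<in> borel_measurable borel \<longrightarrow> distr M borel S = M \<longrightarrow>
      (\<integral>x. indicator {x. \<bar>S x - x\<bar> \<le> e2} x * norm (H (S x) - H x) \<partial>M) \<le> \<eta> / 2)" ..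
    show "\<exists>\<epsilon>>0. \<forall>S. S \<in> borel_measurable borel \<longrightarrow> distr M borel S = M \<longrightarrow>
      (\<integral>x. indicator {x. \<bar>S x - x\<bar> \<le> \<epsilon>} x * norm (F (S x) + H (S x) - (F x + H x)) \<partial>M) \<le> \<eta>"
    proof (intro exI[of _ "min e1 e2"] conjI allI impI)
      show "min e1 e2 > 0" using e1 e2 by simp
      fix S assume S: "S \<in> borel_measurable borel" "distr M borel S = M"
      let ?A = "\<lambda>e. {x. \<bar>S x - x\<bar> \<le> e}"
      have A: "?A e \<in> sets M" for e
        using near_set_borel[OF S(1)] sets by simp
      have b: "F \<in> borel_measurable borel" "H \<in> borel_measurable borel"
        using borel_measurable_integrable add(1,2) sets measurable_cong_sets by blast+
      note i = integrable_invariant[OF sets S]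
      have FI: "integrable M (\<lambda>x. indicator (?A e1) x * norm (F (S x) - F x))"
        using integrable_mult_indicator[OF A, of "\<lambda>x. norm (F (S x) - F x)"] i[OF b(1) add(1)] add(1) by simp
      have HI: "integrable M (\<lambda>x. indicator (?A e2) x * norm (H (S x) - H x))"
        using integrable_mult_indicator[OF A, of "\<lambda>x. norm (H (S x) - H x)"] i[OF b(2) add(2)] add(2) by simp
      have "(\<integral>x. indicator (?A (min e1 e2)) x * norm (F (S x) + H (S x) - (F x + H x)) \<partial>M) \<le>
        (\<integral>x. indicator (?A e1) x * norm (F (S x) - F x) + indicator (?A e2) x * norm (H (S x) - H x) \<partial>M)"
      proof (intro integral_mono_AE' AE_I2)
        fix x
        show "indicator (?A (min e1 e2)) x * norm (F (S x) + H (S x) - (F x + H x)) \<le>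
          indicator (?A e1) x * norm (F (S x) - F x) + indicator (?A e2) x * norm (H (S x) - H x)"
          using norm_diff_triangle_ineq[of "F (S x)" "H (S x)" "F x" "H x"] by (auto simp: indicator_def)
      qed (use FI HI in \<open>auto simp: indicator_def\<close>)
      also have "\<dots> = (\<integral>x. indicator (?A e1) x * norm (F (S x) - F x) \<partial>M) +
          (\<integral>x. indicator (?A e2) x * norm (H (S x) - H x) \<partial>M)"
        using FI HI by simp
      also have "\<dots> \<le> \<eta>" using conjunct2[OF e1, rule_format, OF S] conjunct2[OF e2, rule_format, OF S] by simp
      finally show "(\<integral>x. indicator (?A (min e1 e2)) x * norm (F (S x) + H (S x) - (F x + H x)) \<partial>M) \<le> \<eta>" .
    qed
  qed
next
  case (lim F s)
  have "(\<lambda>i. \<integral>x. norm (F x - s i x) \<partial>M) \<longlonglongrightarrow> (\<integral>x. 0 \<partial>M)"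
  proof (rule integral_dominated_convergence)
    \<comment> \<open>The approximants satisfy \<open>norm (s i x) \<le> 2 * norm (F x)\<close>,
      hence the 3.\<close>
    show "integrable M (\<lambda>x. 3 * norm (F x))" using lim(4) by auto
    show "AE x in M. (\<lambda>i. norm (F x - s i x)) \<longlonglongrightarrow> 0"
    proof (intro AE_I2)
      fix x assume "x \<in> space M"
      then have "(\<lambda>i. norm (F x - s i x)) \<longlonglongrightarrow> norm (F x - F x)"
        by (intro tendsto_intros lim(2))
      then show "(\<lambda>i. norm (F x - s i x)) \<longlonglongrightarrow> 0" by simp
    qed
    show "AE x in M. norm (norm (F x - s i x)) \<le> 3 * norm (F x)" for i
    proof (intro AE_I2)
      fix x assume "x \<in> space M"
      from lim(3)[OF this, of i] show "norm (norm (F x - s i x)) \<le> 3 * norm (F x)"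
        using norm_triangle_ineq4[of "F x" "s i x"] by simp
    qed
  qed (use lim(1,4) in auto)
  then have conv: "(\<lambda>i. \<integral>x. norm (F x - s i x) \<partial>M) \<longlonglongrightarrow> 0" by simp
  show ?case
    unfolding almost_invariant_def
  proof (intro allI impI)
    fix \<eta> :: real assume \<eta>: "\<eta> > 0"
    then have "\<forall>\<^sub>F i in sequentially. (\<integral>x. norm (F x - s i x) \<partial>M) < \<eta> / 4"
      by (intro order_tendstoD(2)[OF conv]) simp
    then obtain i where i: "(\<integral>x. norm (F x - s i x) \<partial>M) < \<eta> / 4"
      by (auto simp: eventually_sequentially)
    have \<eta>2: "\<eta> / 2 > 0" using \<eta> by simp
    from lim(5)[unfolded almost_invariant_def, THEN spec, THEN mp, OF \<eta>2]
    obtain e where e: "e > 0 \<and> (\<forall>S. S \<in> borel_measurable borel \<longrightarrow> distr M borel S = M \<longrightarrow>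
      (\<integral>x. indicator {x. \<bar>S x - x\<bar> \<le> e} x * norm (s i (S x) - s i x) \<partial>M) \<le> \<eta> / 2)" ..
    have *: "(\<integral>x. indicator {x. \<bar>S x - x\<bar> \<le> e} x * norm (F (S x) - F x) \<partial>M) \<le> \<eta>"
      if S: "S \<in> borel_measurable borel" "distr M borel S = M" for S
      using near_integral_le[OF sets S lim(4,1) order_refl, of e i] conjunct2[OF e, rule_format, OF S] i
      by linarith
    show "\<exists>\<epsilon>>0. \<forall>S. S \<in> borel_measurable borel \<longrightarrow> distr M borel S = M \<longrightarrow>
     (\<integral>x. indicator {x. \<bar>S x - x\<bar> \<le> \<epsilon>} x * norm (F (S x) - F x) \<partial>M) \<le> \<eta>"
      by (intro exI[of _ e] conjI conjunct1[OF e] allI impI) (rule *)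
  qed
qed

text \<open>After s steps F changes by |c^s - 1| |F|. The points that almost return after s steps
  carry at least 1/8 of the integral I of |F|, so almost invariance bounds |c^s - 1| I / 8 by
  \<eta>, for two consecutive exponents s.\<close>

lemma eigenvalue_eq_1:
  assumes p: "p \<in> Omega_inf" and good: "\<And>N. \<exists>n a b. good N n a b (digits p)"
    and M: "inv_prob (fst p) (snd p) M" and c: "norm c = 1"
    and ev: "is_eigenvalue (fst p) (snd p) M c"
  shows "c = 1"
proof (rule ccontr)
  assume "c \<noteq> 1"
  interpret prob_space M using M by (simp add: inv_prob_def)
  let ?T = "Tmap p"
  have sets: "sets M = sets borel" and inv: "distr M borel ?T = M"
    and Om: "emeasure M (Omega (fst p) (snd p)) = 1"
    using M by (auto simp: inv_prob_def)
  have T: "?T \<in> borel_measurable borel" by simp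
  note Ti = funpow_invariant[OF sets T inv]
  obtain F where F: "F \<in> borel_measurable M" "integrable M (\<lambda>x. (norm (F x))\<^sup>2)"
    "\<not> (AE x in M. F x = 0)" "AE x in M. F (?T x) = c * F x"
    using ev by (auto simp: is_eigenvalue_def)
  have Fint: "integrable M F"
  proof (rule Bochner_Integration.integrable_bound[OF _ F(1)])
    show "integrable M (\<lambda>x. 1 + (norm (F x))\<^sup>2)" using F(2) by simp
    have "t \<le> 1 + t\<^sup>2" for t :: real using zero_le_square[of "t - 1/2"] by (simp add: power2_eq_square algebra_simps)
    then show "AE x in M. norm (F x) \<le> norm (1 + (norm (F x))\<^sup>2)" by simp
  qed
  define g where "g = (\<lambda>x. norm (F x))"
  have g: "integrable M g" "\<And>x. 0 \<le> g x" using Fint by (auto simp: g_def)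
  have ginv: "AE x in M. g (?T x) = g x"
    using F(4) by eventually_elim (simp add: g_def norm_mult c)
  define I where "I = (\<integral>x. g x \<partial>M)"
  have "I \<noteq> 0"
    using F(3) integral_nonneg_eq_0_iff_AE[OF g(1)] g(2) by (auto simp: I_def g_def)
  moreover have "I \<ge> 0" unfolding I_def by (intro integral_nonneg_AE AE_I2 g)
  ultimately have I: "I > 0" by simp
  \<comment> \<open>32 = 8 * 2 * 2: the share 1/8, the two exponents, and a final bound of half of
    \<open>norm (c - 1)\<close>.\<close>
  define \<eta> where "\<eta> = norm (c - 1) * I / 32"
  have \<eta>: "\<eta> > 0" using I \<open>c \<noteq> 1\<close> by (simp add: \<eta>_def)
  from almost_invariant_integrable[OF finite_measure_axioms sets Fint, unfolded almost_invariant_def, THEN spec, THEN mp, OF \<eta>]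
  obtain e where e: "e > 0 \<and> (\<forall>S. S \<in> borel_measurable borel \<longrightarrow> distr M borel S = M \<longrightarrow>
    (\<integral>x. indicator {x. \<bar>S x - x\<bar> \<le> e} x * norm (F (S x) - F x) \<partial>M) \<le> \<eta>)" ..
  note near = conjunct2[OF e, rule_format]
  obtain N :: nat where N: "N > 0" "1 / N \<le> e"
    using real_arch_inverse[of e] conjunct1[OF e] by (auto simp: inverse_eq_divide intro: less_imp_le)
  obtain n a b where gd: "good N n a b (digits p)" using good by blast
  from good_recurrence[OF p gd N(1)] obtain t B where tB: "\<forall>s\<in>{t, Suc t}. \<forall>x\<in>{0..1}. \<forall>m.
    real m \<le> 8 * visits ?T {z. \<bar>(?T ^^ s) z - z\<bar> \<le> 1 / N} x m + real B"
    by (elim exE)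
  have unit: "AE x in M. x \<in> {0..1}"
  proof -
    have "Omega (fst p) (snd p) \<subseteq> closure ((?T ^^ 0) ` {0..1})"
      unfolding Omega_def by (rule INF_lower) simp
    then have sub: "Omega (fst p) (snd p) \<subseteq> {0..1}" by simp
    \<comment> \<open>Measurability is read off from the mass 1, as non-measurable sets have
      \<open>emeasure\<close> 0.\<close>
    have "Omega (fst p) (snd p) \<in> sets M"
      using emeasure_notin_sets[of "Omega (fst p) (snd p)" M] Om by fastforce
    then have "AE x in M. x \<in> Omega (fst p) (snd p)"
      using Om by (intro AE_prob_1) (simp add: emeasure_eq_measure)
    then show ?thesis
      by (rule AE_mp) (intro AE_I2 impI, rule subsetD[OF sub])
  qed
  have Fi: "AE x in M. F ((?T ^^ i) x) = c ^ i * F x" for i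
  proof (induction i)
    case (Suc i)
    show ?case
      using AE_invariant[OF sets T inv Suc] F(4)
      by eventually_elim (simp add: funpow_swap1)
  qed simp
  have close: "norm (c ^ s - 1) \<le> 8 * \<eta> / I" if s: "s \<in> {t, Suc t}" for s
  proof -
    let ?A = "\<lambda>e. {z. \<bar>(?T ^^ s) z - z\<bar> \<le> e}"
    have A: "?A r \<in> sets borel" for r by (rule near_set_borel[OF Ti(1)])
    have "AE x in M. \<forall>m. real m \<le> 8 * visits ?T (?A (1 / N)) x m + real B"
      using unit by (rule AE_mp) (intro AE_I2 impI, rule bspec[OF bspec[OF tB s]])
    from integral_le_visits[OF sets T inv g ginv A this]
    have 1: "I \<le> 8 * (\<integral>x. indicator (?A (1 / N)) x * g x \<partial>M)" by (simp add: I_def)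
    have ig: "integrable M (\<lambda>x. indicator (?A r) x * g x)" for r
      using integrable_mult_indicator[of "?A r" M g] A g(1) by (simp add: sets)
    have "(\<integral>x. indicator (?A (1 / N)) x * g x \<partial>M) \<le> (\<integral>x. indicator (?A e) x * g x \<partial>M)"
      using N(2) g(2) by (intro integral_mono ig) (auto simp: indicator_def)
    with 1 have "norm (c ^ s - 1) * I \<le> norm (c ^ s - 1) * (8 * (\<integral>x. indicator (?A e) x * g x \<partial>M))"
      by (intro mult_left_mono) auto
    also have "\<dots> = 8 * (\<integral>x. norm (c ^ s - 1) * (indicator (?A e) x * g x) \<partial>M)" by simp
    also have "(\<integral>x. norm (c ^ s - 1) * (indicator (?A e) x * g x) \<partial>M) =
        (\<integral>x. indicator (?A e) x * norm (F ((?T ^^ s) x) - F x) \<partial>M)"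
    proof (rule integral_cong_AE)
      have Fb: "F \<in> borel_measurable borel" using F(1) sets measurable_cong_sets by blast
      show "(\<lambda>x. norm (c ^ s - 1) * (indicator (?A e) x * g x)) \<in> borel_measurable M"
        using borel_measurable_integrable[OF ig[of e]] by measurable
      have "integrable M (\<lambda>x. F ((?T ^^ s) x))"
        by (rule integrable_invariant[OF sets Ti Fb Fint])
      then have "integrable M (\<lambda>x. norm (F ((?T ^^ s) x) - F x))" using Fint by auto
      from integrable_mult_indicator[OF _ this, of "?A e"]
      show "(\<lambda>x. indicator (?A e) x * norm (F ((?T ^^ s) x) - F x)) \<in> borel_measurable M"
        using A by (auto simp: sets)
      show "AE x in M. norm (c ^ s - 1) * (indicator (?A e) x * g x) =
          indicator (?A e) x * norm (F ((?T ^^ s) x) - F x)"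
        using Fi[of s]
      proof eventually_elim
        case (elim x)
        have "c ^ s * F x - F x = (c ^ s - 1) * F x" by (simp add: algebra_simps)
        then show ?case unfolding elim by (simp add: g_def norm_mult)
      qed
    qed
    also have "\<dots> \<le> \<eta>" by (rule near[OF Ti])
    finally show ?thesis using I by (simp add: field_simps)
  qed
  \<comment> \<open>As |c| = 1, the factor c^t is free and turns c - 1 into a difference of two
    small quantities.\<close>
  have "norm (c - 1) = norm (c ^ t * (c - 1))" by (simp add: norm_mult norm_power c)
  also have "\<dots> = norm ((c ^ Suc t - 1) - (c ^ t - 1))" by (simp add: algebra_simps)
  also have "\<dots> \<le> 8 * \<eta> / I + 8 * \<eta> / I"
    by (rule order_trans[OF norm_triangle_ineq4 add_mono]) (intro close; simp)+
  also have "\<dots> = norm (c - 1) / 2" using I by (simp add: \<eta>_def)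
  finally show False using \<open>c \<noteq> 1\<close> by simp
qed

theorem theorem3p11:
  shows "\<exists>D. gdelta_in (top_of_set Omega_inf) D \<and> Omega_inf \<subseteq> closure D \<and>
     D \<subseteq> {(\<alpha>, \<beta>) \<in> Omega_inf.
             \<not> (\<exists>\<xi>::real. 0 < \<xi> \<and> \<xi> < 1 \<and>
                   has_eigenvalue \<alpha> \<beta> (exp (2 * of_real pi * \<i> * of_real \<xi>)))}"
proof (intro exI[of _ "{p \<in> Omega_inf. \<forall>N. \<exists>n a b. good N n a b (digits p)}"] conjI dense_gdelta_good)
  have "\<not> has_eigenvalue (fst p) (snd p) (exp (2 * of_real pi * \<i> * of_real \<xi>))"
    if p: "p \<in> Omega_inf" "\<forall>N. \<exists>n a b. good N n a b (digits p)" and \<xi>: "0 < \<xi>" "\<xi> < 1" for p and \<xi> :: real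
  proof
    let ?c = "exp (2 * of_real pi * \<i> * of_real \<xi>) :: complex"
    assume "has_eigenvalue (fst p) (snd p) ?c"
    then obtain M where M: "inv_prob (fst p) (snd p) M" "is_eigenvalue (fst p) (snd p) M ?c"
      by (auto simp: has_eigenvalue_def)
    have "?c = 1"
      using p(2) by (intro eigenvalue_eq_1[OF p(1) _ M(1) _ M(2)]) auto
    then obtain k :: int where "2 * pi * \<xi> = of_int (2 * k) * pi"
      by (auto simp: exp_eq_1)
    then have "\<xi> = of_int k" by simp
    then show False using \<xi> by simp
  qed
  then show "{p \<in> Omega_inf. \<forall>N. \<exists>n a b. good N n a b (digits p)} \<subseteq> {(\<alpha>, \<beta>) \<in> Omega_inf.
     \<not> (\<exists>\<xi>::real. 0 < \<xi> \<and> \<xi> < 1 \<and> has_eigenvalue \<alpha> \<beta> (exp (2 * of_real pi * \<i> * of_real \<xi>)))}"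
    by force
qed

end
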